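(* Let $0<\beta<1$, $0\le\alpha<n$, $0<\alpha+\beta<n$, $b\in L^1_{\rm loc}(\mathbb{R}^n)$, let $\Phi,\Psi$ be Young functions and $\Phi\in\mathcal{Y}$. 1. Suppose $\Phi\in\nabla_2$ and there is a constant $C>0$ such that $t^{-\frac{\alpha+\beta}{n}}\Phi^{-1}(t)\le C\,\Psi^{-1}(t)$ for all $t>0$. Then the condition $b\in\dot\Lambda_\beta(\mathbb{R}^n)$ is sufficient for the boundedness of $M_{b,\alpha}$ from $L^\Phi(\mathbb{R}^n)$ to $L^\Psi(\mathbb{R}^n)$. 2. Suppose there is a constant $C>0$ such that $\Psi^{-1}(t)\le C\,\Phi^{-1}(t)\,t^{-\frac{\alpha+\beta}{n}}$ for all $t>0$. Then the condition $b\in\dot\Lambda_\beta(\mathbb{R}^n)$ is necessary for the boundedness of $M_{b,\alpha}$ from $L^\Phi(\mathbb{R}^n)$ to $L^\Psi(\mathbb{R}^n)$. 3. Suppose $\Phi\in\nabla_2$ and there are constants $C_1,C_2>0$ such that $C_1\Phi^{-1}(t)t^{-\frac{\alpha+\beta}{n}}\le\Psi^{-1}(t)\le C_2\Phi^{-1}(t)t^{-\frac{\alpha+\beta}{n}}$ for all $t>0$. Then the condition $b\in\dot\Lambda_\beta(\mathbb{R}^n)$ is necessary and sufficient for the boundedness of $M_{b,\alpha}$ from $L^\Phi(\mathbb{R}^n)$ to $L^\Psi(\mathbb{R}^n)$.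
   Context: A Young function is a convex, left-continuous function $\Phi:[0,\infty)\to[0,\infty]$ with $\lim_{r\to0+}\Phi(r)=\Phi(0)=0$ and $\lim_{r\to\infty}\Phi(r)=\infty$. $\mathcal{Y}$ is the set of Young functions with $0<\Phi(r)<\infty$ for all $0<r<\infty$. For a Young function, $\Phi^{-1}(s)=\inf\{r\ge0:\Phi(r)>s\}$. $\Phi\in\nabla_2$ means that there is $C>1$ with $\Phi(r)\le\frac{1}{2C}\Phi(Cr)$ for all $r\ge0$. The Orlicz space $L^\Phi(\mathbb{R}^n)$ is the set of $f\in L^1_{\rm loc}(\mathbb{R}^n)$ with $\int_{\mathbb{R}^n}\Phi(k|f(x)|)\,dx<\infty$ for some $k>0$, with norm $\|f\|_{L^\Phi}=\inf\{\lambda>0:\int_{\mathbb{R}^n}\Phi(|f(x)|/\lambda)\,dx\le1\}$. The fractional maximal commutator is $M_{b,\alpha}f(x)=\sup_{B\ni x}|B|^{-1+\frac{\alpha}{n}}\int_B|b(x)-b(y)||f(y)|\,dy$, the supremum being over all balls $B\subset\mathbb{R}^n$ containing $x$. An operator $T$ is bounded from $X$ to $Y$ if there is a constant $C$ with $\|Tf\|_Y\le C\|f\|_X$ for all $f\in X$. For $0<\beta<1$, $b\in\dot\Lambda_\beta(\mathbb{R}^n)$ (Lipschitz space) means there is a constant $C$ with $|b(x)-b(y)|\le C|x-y|^\beta$ for all $x,y\in\mathbb{R}^n$ (for a locally integrable $b$, understood up to modification on a null set). *)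

theory Defs
  imports "HOL-Analysis.Analysis"
begin

text \<open>
  A Young function lives on \<open>[0, \<infinity>)\<close>; it is represented by a function on the reals whose values
  at negative arguments are never used.
\<close>

definition young_function :: "(real \<Rightarrow> ennreal) \<Rightarrow> bool" where
  "young_function \<Phi> \<longleftrightarrow>
     (\<forall>x\<ge>0. \<forall>y\<ge>0. \<forall>u\<in>{0..1}.
        \<Phi> ((1 - u) * x + u * y) \<le> ennreal (1 - u) * \<Phi> x + ennreal u * \<Phi> y) \<and>
     (\<forall>r>0. (\<Phi> \<longlongrightarrow> \<Phi> r) (at_left r)) \<and>
     \<Phi> 0 = 0 \<and> (\<Phi> \<longlongrightarrow> 0) (at_right 0) \<and> (\<Phi> \<longlongrightarrow> \<infinity>) at_top"

definition young_class_Y :: "(real \<Rightarrow> ennreal) set" where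
  "young_class_Y = {\<Phi>. young_function \<Phi> \<and> (\<forall>r>0. 0 < \<Phi> r \<and> \<Phi> r < \<infinity>)}"

text \<open>
  The set below is nonempty for every Young function, since it tends to \<open>\<infinity>\<close>; hence the infimum
  can be taken in the reals.
\<close>

definition young_inverse :: "(real \<Rightarrow> ennreal) \<Rightarrow> real \<Rightarrow> real" where
  "young_inverse \<Phi> s = Inf {r. 0 \<le> r \<and> ennreal s < \<Phi> r}"

definition nabla2 :: "(real \<Rightarrow> ennreal) \<Rightarrow> bool" where
  "nabla2 \<Phi> \<longleftrightarrow> (\<exists>C>1. \<forall>r\<ge>0. \<Phi> r \<le> ennreal (1 / (2 * C)) * \<Phi> (C * r))"

text \<open>
  Maximal functions may take the value \<open>\<infinity>\<close>, so \<open>\<Phi>\<close> is extended by \<open>\<Phi>(\<infinity>) = \<infinity>\<close> and the Luxemburg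
  norm is defined for functions with values in \<open>[0, \<infinity>]\<close>, with \<open>inf \<emptyset> = \<infinity>\<close>.
\<close>

definition young_ext :: "(real \<Rightarrow> ennreal) \<Rightarrow> ennreal \<Rightarrow> ennreal" where
  "young_ext \<Phi> t = (if t = \<infinity> then \<infinity> else \<Phi> (enn2real t))"

definition orlicz_norm :: "(real \<Rightarrow> ennreal) \<Rightarrow> (real^'n \<Rightarrow> ennreal) \<Rightarrow> ennreal" where
  "orlicz_norm \<Phi> g =
     Inf {ennreal l | l. 0 < l \<and> (\<integral>\<^sup>+ x. young_ext \<Phi> (g x / ennreal l) \<partial>lebesgue) \<le> 1}"

definition locally_integrable :: "(real^'n \<Rightarrow> real) \<Rightarrow> bool" where
  "locally_integrable f \<longleftrightarrow> (\<forall>K. compact K \<longrightarrow> f absolutely_integrable_on K)"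

definition orlicz_space :: "(real \<Rightarrow> ennreal) \<Rightarrow> (real^'n \<Rightarrow> real) set" where
  "orlicz_space \<Phi> =
     {f. locally_integrable f \<and> (\<exists>k>0. (\<integral>\<^sup>+ x. \<Phi> (k * \<bar>f x\<bar>) \<partial>lebesgue) < \<infinity>)}"

definition frac_max_commutator ::
  "(real^'n \<Rightarrow> real) \<Rightarrow> real \<Rightarrow> (real^'n \<Rightarrow> real) \<Rightarrow> real^'n \<Rightarrow> ennreal" where
  "frac_max_commutator b \<alpha> f x =
     (SUP B \<in> {ball c r | c r. 0 < r \<and> x \<in> ball c r}.
        ennreal (measure lebesgue B powr (-1 + \<alpha> / real CARD('n))) *
        (\<integral>\<^sup>+ y\<in>B. ennreal (\<bar>b x - b y\<bar> * \<bar>f y\<bar>) \<partial>lebesgue))"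

definition orlicz_bounded ::
  "(real \<Rightarrow> ennreal) \<Rightarrow> (real \<Rightarrow> ennreal) \<Rightarrow> ((real^'n \<Rightarrow> real) \<Rightarrow> real^'n \<Rightarrow> ennreal) \<Rightarrow> bool" where
  "orlicz_bounded \<Phi> \<Psi> T \<longleftrightarrow>
     (\<exists>C\<ge>0. \<forall>f\<in>orlicz_space \<Phi>.
        orlicz_norm \<Psi> (T f) \<le> ennreal C * orlicz_norm \<Phi> (\<lambda>x. ennreal \<bar>f x\<bar>))"

definition lipschitz_space :: "real \<Rightarrow> (real^'n \<Rightarrow> real) set" where
  "lipschitz_space \<beta> =
     {b. \<exists>b'. (AE x in lebesgue. b x = b' x) \<and>
              (\<exists>C. \<forall>x y. \<bar>b' x - b' y\<bar> \<le> C * norm (x - y) powr \<beta>)}"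

end

theory Submission
  imports Defs
begin

text \<open>
  Sufficiency. If \<open>b\<close> is Lipschitz of order \<open>\<beta>\<close>, the commutator is dominated by the fractional maximal
  function of order \<open>\<gamma> = \<alpha> + \<beta>\<close>. A ball average of a function \<open>G\<close> with modular at most \<open>1\<close> is bounded both
  by \<open>M G(x)\<close> and by a multiple of \<open>\<Phi>\<^sup>-\<^sup>1(1/\<bar>B\<bar>)\<close>; comparing \<open>1/\<bar>B\<bar>\<close> with \<open>\<Phi>(M G(x))\<close> gives Hedberg's
  estimate \<open>M\<^sub>\<gamma> G(x) \<le> C \<Psi>\<^sup>-\<^sup>1(\<Phi>(M G(x)))\<close>, and \<open>\<Psi>(\<Psi>\<^sup>-\<^sup>1(s)) \<le> s\<close> reduces the claim to the boundedness
  of \<open>M\<close> on \<open>L\<^sup>\<Phi>\<close>, which follows from the weak type inequality and \<open>\<nabla>\<^sub>2\<close>.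

  Necessity. Testing on the indicator of a ball \<open>B\<close> bounds the mean oscillation of \<open>b\<close> over \<open>B\<close> by a
  multiple of \<open>r\<^sup>\<beta>\<close>. By Campanato's argument the averages of \<open>b\<close> over shrinking balls then converge
  everywhere to a Hoelder function, which agrees with \<open>b\<close> almost everywhere.
\<close>

section \<open>Young functions\<close>

text \<open>Both directions rest on one linear inequality: if \<open>\<Phi> u > 1 / V\<close>, then
  \<open>v \<le> u + u * V * \<Phi> v\<close>. Integrated over a set of measure \<open>V\<close>, it
  turns a modular bound into a bound for the integral. Sufficiency uses it with
  \<open>\<Phi>\<close> for ball averages of \<open>G\<close>, necessity with \<open>\<Psi>\<close>
  for the oscillation of \<open>b\<close>. Membership in \<open>young_class_Y\<close> makes \<Phi>(M
  G(x)) a positive real wherever M G(x) is positive and finite, so it can be compared with 1/|B|: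
  small balls are handled by the maximal function, large ones by the modular. In the bound for M,
  \<nabla>_2 acts as geometric decay: with the range cut at powers of its constant C, the weak type
  weight grows by C per layer downwards while \<Phi> shrinks by 2C. In the necessity direction,
  oscillation is a double integral of |b(x) - b(y)| over B x B. Testing on the indicator of B
  produces exactly this quantity, and it lives in [0, \<infinity>] without integrability conditions;
  averages of \<open>b\<close> appear only afterwards.\<close>

lemma young_convex:
  assumes "young_function \<Phi>" "0 \<le> x" "0 \<le> y" "0 \<le> u" "u \<le> 1"
  shows "\<Phi> ((1 - u) * x + u * y) \<le> ennreal (1 - u) * \<Phi> x + ennreal u * \<Phi> y"
  using assms unfolding young_function_def by auto

lemma young_zero: "young_function \<Phi> \<Longrightarrow> \<Phi> 0 = 0"
  unfolding young_function_def by auto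

lemma young_scale:
  assumes "young_function \<Phi>" "0 \<le> y" "0 \<le> u" "u \<le> 1"
  shows "\<Phi> (u * y) \<le> ennreal u * \<Phi> y"
  using young_convex[OF assms(1), of 0 y u] young_zero[OF assms(1)] assms by simp

lemma young_mono:
  assumes "young_function \<Phi>" "0 \<le> x" "x \<le> y"
  shows "\<Phi> x \<le> \<Phi> y"
proof (cases "y = 0")
  case False
  with assms have "y > 0" by auto
  have "\<Phi> x = \<Phi> ((x / y) * y)" using \<open>y > 0\<close> by simp
  also have "\<dots> \<le> ennreal (x / y) * \<Phi> y"
    using assms \<open>y > 0\<close> by (intro young_scale) auto
  also have "\<dots> \<le> 1 * \<Phi> y"
    using assms \<open>y > 0\<close> by (intro mult_right_mono) (auto simp: ennreal_le_1)
  finally show ?thesis by simp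
qed (use assms in auto)

lemma young_inverse_set_nonempty:
  assumes "young_function \<Phi>"
  shows "\<exists>r\<ge>0. ennreal s < \<Phi> r"
proof -
  have "(\<Phi> \<longlongrightarrow> \<infinity>) at_top" using assms unfolding young_function_def by auto
  then have "eventually (\<lambda>r. ennreal s < \<Phi> r) at_top"
    by (rule order_tendstoD) simp
  then have "eventually (\<lambda>r. ennreal s < \<Phi> r \<and> 0 \<le> r) at_top"
    by (intro eventually_conj eventually_ge_at_top)
  then show ?thesis
    using eventually_happens'[OF trivial_limit_at_top_linorder] by blast
qed

lemma young_inverse_nonneg:
  assumes "young_function \<Phi>"
  shows "0 \<le> young_inverse \<Phi> s"
  unfolding young_inverse_def using young_inverse_set_nonempty[OF assms, of s]
  by (intro cInf_greatest) auto

lemma young_inverse_mono: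
  assumes "young_function \<Phi>" "s \<le> t"
  shows "young_inverse \<Phi> s \<le> young_inverse \<Phi> t"
  unfolding young_inverse_def
proof (rule cInf_superset_mono)
  show "{r. 0 \<le> r \<and> ennreal t < \<Phi> r} \<noteq> {}"
    using young_inverse_set_nonempty[OF assms(1), of t] by auto
  show "bdd_below {r. 0 \<le> r \<and> ennreal s < \<Phi> r}" by (auto intro: bdd_belowI[of _ 0])
  show "{r. 0 \<le> r \<and> ennreal t < \<Phi> r} \<subseteq> {r. 0 \<le> r \<and> ennreal s < \<Phi> r}"
    using ennreal_leI[OF assms(2)] by (auto intro: le_less_trans)
qed

lemma young_above_inverse:
  assumes "young_function \<Phi>" "young_inverse \<Phi> s < u"
  shows "ennreal s < \<Phi> u"
proof -
  obtain r where r: "0 \<le> r" "ennreal s < \<Phi> r" "r < u"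
    using assms(2) young_inverse_set_nonempty[OF assms(1), of s]
    unfolding young_inverse_def by (subst (asm) cInf_less_iff) (auto intro: bdd_belowI[of _ 0])
  then show ?thesis using young_mono[OF assms(1), of r u] by (auto intro: less_le_trans)
qed

lemma young_below_inverse:
  assumes "young_function \<Phi>" "0 \<le> u" "u < young_inverse \<Phi> s"
  shows "\<Phi> u \<le> ennreal s"
proof (rule ccontr)
  assume "\<not> \<Phi> u \<le> ennreal s"
  then have "young_inverse \<Phi> s \<le> u"
    unfolding young_inverse_def using assms(2) by (intro cInf_lower bdd_belowI[of _ 0]) auto
  with assms(3) show False by simp
qed

text \<open>Left-continuity is decisive: every nonnegative \<open>u\<close> below the infimum
  satisfies \<open>\<Phi> u \<le> s\<close>, and this passes to the limit from the left. Just to the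
  right \<open>\<Phi>\<close> may jump to \<infinity>. With infimum 0 there is nothing on the left,
  but \<open>\<Phi> 0 = 0\<close>.\<close>

lemma young_at_inverse:
  assumes "young_function \<Phi>"
  shows "\<Phi> (young_inverse \<Phi> s) \<le> ennreal s"
proof (cases "young_inverse \<Phi> s = 0")
  case False
  then have pos: "0 < young_inverse \<Phi> s" using young_inverse_nonneg[OF assms, of s] by auto
  have "(\<Phi> \<longlongrightarrow> \<Phi> (young_inverse \<Phi> s)) (at_left (young_inverse \<Phi> s))"
    using assms pos unfolding young_function_def by auto
  moreover have "eventually (\<lambda>u. \<Phi> u \<le> ennreal s) (at_left (young_inverse \<Phi> s))"
    using eventually_at_left_real[OF pos]
    by eventually_elim (auto intro: young_below_inverse[OF assms])
  ultimately show ?thesis by (rule tendsto_upperbound) simp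
qed (use young_zero[OF assms] in auto)

lemma young_inverse_pos:
  assumes "young_function \<Phi>" "0 < s"
  shows "0 < young_inverse \<Phi> s"
proof -
  have "(\<Phi> \<longlongrightarrow> 0) (at_right 0)" using assms unfolding young_function_def by auto
  then have "eventually (\<lambda>r. \<Phi> r < ennreal s) (at_right 0)"
    by (rule order_tendstoD) (use assms in simp)
  then obtain d where d: "d > 0" "\<And>r. 0 < r \<Longrightarrow> r < d \<Longrightarrow> \<Phi> r < ennreal s"
    unfolding eventually_at_right_field by auto
  have "d / 2 \<le> young_inverse \<Phi> s"
  proof (rule ccontr)
    assume "\<not> d / 2 \<le> young_inverse \<Phi> s"
    then have "ennreal s < \<Phi> (d / 2)" by (intro young_above_inverse[OF assms(1)]) auto
    with d(2)[of "d / 2"] d(1) show False by auto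
  qed
  with d(1) show ?thesis by auto
qed

lemma le_young_inverse:
  assumes "young_function \<Phi>" "\<Phi> m \<le> ennreal s" "0 \<le> m"
  shows "m \<le> young_inverse \<Phi> s"
  using young_above_inverse[OF assms(1), of s m] assms(2) by (meson leD not_less)

lemma young_ext_ennreal: "0 \<le> r \<Longrightarrow> young_ext \<Phi> (ennreal r) = \<Phi> r"
  unfolding young_ext_def by simp

lemma young_ext_mono:
  assumes "young_function \<Phi>" "s \<le> t"
  shows "young_ext \<Phi> s \<le> young_ext \<Phi> t"
  unfolding young_ext_def using assms
  by (auto intro!: young_mono enn2real_mono simp: top.not_eq_extremum)

text \<open>Monotonicity suffices: a sublevel set is an initial segment of [0, \<infinity>], hence
  an open or closed ray ending at its supremum.\<close>

lemma young_ext_measurable [measurable]: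
  assumes "young_function \<Phi>"
  shows "young_ext \<Phi> \<in> borel_measurable borel"
proof (rule borel_measurableI_le)
  fix y
  let ?S = "{t. young_ext \<Phi> t \<le> y}"
  have down: "s \<in> ?S" if "t \<in> ?S" "s \<le> t" for s t
    using that young_ext_mono[OF assms, of s t] by auto
  have "?S = {..Sup ?S} \<or> ?S = {..<Sup ?S}"
  proof (cases "Sup ?S \<in> ?S")
    case True
    then have "?S = {..Sup ?S}" using down[OF True] Sup_upper[of _ ?S] by blast
    then show ?thesis ..
  next
    case False
    have "?S = {..<Sup ?S}"
    proof (intro set_eqI iffI)
      fix t assume t: "t \<in> ?S"
      then have "t \<le> Sup ?S" by (rule Sup_upper)
      moreover have "t \<noteq> Sup ?S" using t False by metis
      ultimately show "t \<in> {..<Sup ?S}" by simp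
    next
      fix t assume "t \<in> {..<Sup ?S}"
      then obtain s where "s \<in> ?S" "t < s" unfolding lessThan_iff less_Sup_iff by blast
      then show "t \<in> ?S" using down by (meson less_imp_le)
    qed
    then show ?thesis ..
  qed
  then have "?S \<in> sets borel" by (metis borel_closed borel_open closed_atMost open_lessThan)
  then show "{x \<in> space borel. young_ext \<Phi> x \<le> y} \<in> sets borel" by simp
qed

text \<open>Integrated over a set of measure \<open>V\<close>, this replaces Jensen's inequality, at the cost of a factor \<open>2\<close>.\<close>

lemma young_ext_linear_bound:
  assumes "young_function \<Phi>" "0 < V" "ennreal (1 / V) < \<Phi> u" "0 \<le> u"
  shows "v \<le> ennreal u + ennreal (u * V) * young_ext \<Phi> v"
proof -
  have u: "0 < u" using assms young_zero[OF assms(1)] by (cases "u = 0") auto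
  show ?thesis
  proof (cases v)
    case top
    then show ?thesis using u assms(2) by (simp add: young_ext_def ennreal_mult_top)
  next
    case (real w)
    show ?thesis
    proof (cases "w \<le> u")
      case True
      then show ?thesis using real by (simp add: ennreal_leI add_increasing2)
    next
      case False
      \<comment> \<open>Convexity through the origin:
        \<open>\<Phi> u \<le> (u / w) * \<Phi> w\<close> for \<open>u < w\<close>. Multiplying
        \<open>1 / V < \<Phi> u\<close> by \<open>w * V\<close> then bounds \<open>w\<close> by the
        second summand alone.\<close>
      have "ennreal (1 / V) \<le> \<Phi> u" using assms by simp
      also have "\<Phi> u = \<Phi> ((u / w) * w)" using False u by simp
      also have "\<dots> \<le> ennreal (u / w) * \<Phi> w" using False u by (intro young_scale[OF assms(1)]) auto
      finally have "ennreal (w * V) * ennreal (1 / V) \<le> ennreal (w * V) * (ennreal (u / w) * \<Phi> w)"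
        by (rule mult_left_mono) simp
      moreover have "ennreal (w * V) * ennreal (1 / V) = ennreal w"
        using assms False u by (subst ennreal_mult[symmetric]) auto
      moreover have "ennreal (w * V) * (ennreal (u / w) * \<Phi> w) = ennreal (u * V) * \<Phi> w"
        using assms False u by (simp add: mult.assoc[symmetric] ennreal_mult[symmetric] mult.commute[of V])
      ultimately show ?thesis using real by (simp add: young_ext_ennreal add_increasing)
    qed
  qed
qed

section \<open>The Hardy-Littlewood maximal function\<close>

text \<open>\<open>lebesgue\<close> is the completion of \<open>lborel\<close>. As simp rules these
  would rewrite its measure in terms of \<open>lborel\<close>, and facts stated for
  \<open>lebesgue\<close> would no longer match.\<close>

declare emeasure_completion [simp del] measure_completion [simp del]

lemma emeasure_lebesgue_ball:
  fixes c :: "'a::euclidean_space"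
  assumes "0 \<le> r"
  shows "emeasure lebesgue (ball c r) = ennreal (unit_ball_vol (DIM('a)) * r ^ DIM('a))"
  using emeasure_ball[OF assms, of c] by (simp add: emeasure_completion)

lemma measure_lebesgue_ball:
  fixes c :: "'a::euclidean_space"
  assumes "0 \<le> r"
  shows "measure lebesgue (ball c r) = unit_ball_vol (DIM('a)) * r ^ DIM('a)"
  using content_ball[OF assms, of c] by (simp add: measure_completion)

lemma measure_lebesgue_ball_pos:
  fixes c :: "'a::euclidean_space"
  shows "0 < r \<Longrightarrow> 0 < measure lebesgue (ball c r)"
  by (simp add: measure_lebesgue_ball)

lemma emeasure_lebesgue_ball_eq_measure:
  fixes c :: "'a::euclidean_space"
  assumes "0 \<le> r"
  shows "emeasure lebesgue (ball c r) = ennreal (measure lebesgue (ball c r))"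
  using emeasure_lebesgue_ball[OF assms, of c] measure_lebesgue_ball[OF assms, of c] by metis

text \<open>The uncentred Hardy-Littlewood maximal function, over the same balls as
  \<open>frac_max_commutator\<close>, with values in [0, \<infinity>].\<close>

definition maximal_function :: "('a::euclidean_space \<Rightarrow> ennreal) \<Rightarrow> 'a \<Rightarrow> ennreal" where
  "maximal_function g x =
     (SUP B \<in> {ball c r | c r. 0 < r \<and> x \<in> ball c r}.
        (\<integral>\<^sup>+ y\<in>B. g y \<partial>lebesgue) / emeasure lebesgue B)"

lemma average_le_maximal_function:
  assumes "0 < r" "x \<in> ball c r"
  shows "(\<integral>\<^sup>+ y\<in>ball c r. g y \<partial>lebesgue) / emeasure lebesgue (ball c r) \<le> maximal_function g x"
  unfolding maximal_function_def using assms by (intro SUP_upper) auto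

lemma less_maximal_function_iff:
  "t < maximal_function g x \<longleftrightarrow>
     (\<exists>c r. 0 < r \<and> x \<in> ball c r \<and>
        t < (\<integral>\<^sup>+ y\<in>ball c r. g y \<partial>lebesgue) / emeasure lebesgue (ball c r))"
  unfolding maximal_function_def less_SUP_iff by blast

text \<open>A ball with large average is a witness for all of its points at once, so the set is a
  union of balls. Hence superlevel sets are measurable whatever \<open>g\<close> is.\<close>

lemma open_maximal_function_superlevel: "open {x. t < maximal_function g x}"
proof -
  have "{x. t < maximal_function g x} =
    (\<Union>(c, r) \<in> {(c, r). 0 < r \<and> t < (\<integral>\<^sup>+ y\<in>ball c r. g y \<partial>lebesgue) / emeasure lebesgue (ball c r)}. ball c r)"
    unfolding less_maximal_function_iff by blast
  also have "open \<dots>" by auto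
  finally show ?thesis .
qed

lemma maximal_function_superlevel_sets: "{x. t < maximal_function g x} \<in> sets lebesgue"
  using borel_open[OF open_maximal_function_superlevel] by (intro sets_completionI_sets) simp

section \<open>Vitali covering and the weak type inequality\<close>

lemma nn_integral_countable_disjoint_le:
  assumes "countable C" "pairwise (\<lambda>i j. disjnt (S i) (S j)) C"
    and [measurable]: "\<And>i. i \<in> C \<Longrightarrow> S i \<in> sets M" "g \<in> borel_measurable M"
  shows "(\<integral>\<^sup>+ i. (\<integral>\<^sup>+ x\<in>S i. g x \<partial>M) \<partial>count_space C) \<le> (\<integral>\<^sup>+ x. g x \<partial>M)"
proof -
  have "(\<integral>\<^sup>+ i. (\<integral>\<^sup>+ x\<in>S i. g x \<partial>M) \<partial>count_space C) =
        (\<integral>\<^sup>+ i. emeasure (density M g) (S i) \<partial>count_space C)"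
    by (intro nn_integral_cong) (simp add: emeasure_density)
  also have "\<dots> = emeasure (density M g) (\<Union>i\<in>C. S i)"
    using assms by (intro emeasure_UN_countable[symmetric])
      (auto simp: disjoint_family_on_def pairwise_def disjnt_def)
  also have "\<dots> \<le> emeasure (density M g) (space M)"
    using emeasure_space[of "density M g"] by simp
  also have "\<dots> = (\<integral>\<^sup>+ x. g x \<partial>M)"
    by (subst emeasure_density) (auto intro!: nn_integral_cong)
  finally show ?thesis .
qed

text \<open>Countable subadditivity over an arbitrary countable index set: the indicator of the
  union is at most the sum of the indicators, and Tonelli exchanges sum and integral.\<close>

lemma emeasure_UN_countable_le:
  assumes "countable C" and [measurable]: "\<And>i. i \<in> C \<Longrightarrow> S i \<in> sets M"
  shows "emeasure M (\<Union>i\<in>C. S i) \<le> (\<integral>\<^sup>+ i. emeasure M (S i) \<partial>count_space C)"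
proof -
  have "(\<Union>i\<in>C. S i) \<in> sets M" using assms by (intro sets.countable_UN') auto
  then have "emeasure M (\<Union>i\<in>C. S i) = (\<integral>\<^sup>+ x. indicator (\<Union>i\<in>C. S i) x \<partial>M)" by simp
  also have "\<dots> \<le> (\<integral>\<^sup>+ x. (\<integral>\<^sup>+ i. indicator (S i) x \<partial>count_space C) \<partial>M)"
  proof (intro nn_integral_mono)
    fix x
    show "indicator (\<Union>i\<in>C. S i) x \<le> (\<integral>\<^sup>+ i. indicator (S i) x \<partial>count_space C)"
      using nn_integral_ge_point[of _ C "\<lambda>i. indicator (S i) x"]
      by (fastforce simp: indicator_def)
  qed
  also have "\<dots> = (\<integral>\<^sup>+ i. (\<integral>\<^sup>+ x. indicator (S i) x \<partial>M) \<partial>count_space C)"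
    using assms by (intro nn_integral_count_space_nn_integral) auto
  also have "\<dots> = (\<integral>\<^sup>+ i. emeasure M (S i) \<partial>count_space C)"
    using assms by (intro nn_integral_cong) auto
  finally show ?thesis .
qed

text \<open>A comparison of the measures with densities \<open>h\<close> and \<open>g\<close>:
  Vitali's lemma picks disjoint balls whose fivefold enlargements cover \<open>S\<close>, and
  \<open>bound\<close> trades each enlargement for its ball. It serves twice: with
  \<open>h = 1\<close> for the weak type inequality, and with \<open>h = |b - b_rep|\<close> to show
  that this function vanishes almost everywhere.\<close>

lemma nn_integral_le_Vitali:
  fixes a :: "'i \<Rightarrow> 'a::euclidean_space"
  assumes S: "S \<subseteq> (\<Union>i\<in>K. ball (a i) (r i))" "S \<in> sets lebesgue"
    and r: "\<And>i. i \<in> K \<Longrightarrow> 0 < r i \<and> r i \<le> B"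
    and meas [measurable]: "g \<in> borel_measurable lebesgue" "h \<in> borel_measurable lebesgue"
    and bound: "\<And>i. i \<in> K \<Longrightarrow> (\<integral>\<^sup>+ x\<in>ball (a i) (5 * r i). h x \<partial>lebesgue) \<le> (\<integral>\<^sup>+ x\<in>ball (a i) (r i). g x \<partial>lebesgue)"
  shows "(\<integral>\<^sup>+ x\<in>S. h x \<partial>lebesgue) \<le> (\<integral>\<^sup>+ x. g x \<partial>lebesgue)"
proof -
  obtain C where C: "countable C" "C \<subseteq> K"
     "pairwise (\<lambda>i j. disjnt (ball (a i) (r i)) (ball (a j) (r j))) C"
     "S \<subseteq> (\<Union>i\<in>C. ball (a i) (5 * r i))"
    by (rule Vitali_covering_lemma_balls[OF S(1) r])
  have "(\<integral>\<^sup>+ x\<in>S. h x \<partial>lebesgue) = emeasure (density lebesgue h) S"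
    using S by (simp add: emeasure_density)
  also have "\<dots> \<le> emeasure (density lebesgue h) (\<Union>i\<in>C. ball (a i) (5 * r i))"
    using C by (intro emeasure_mono) auto
  also have "\<dots> \<le> (\<integral>\<^sup>+ i. emeasure (density lebesgue h) (ball (a i) (5 * r i)) \<partial>count_space C)"
    using C by (intro emeasure_UN_countable_le) auto
  also have "\<dots> \<le> (\<integral>\<^sup>+ i. (\<integral>\<^sup>+ x\<in>ball (a i) (r i). g x \<partial>lebesgue) \<partial>count_space C)"
    using bound C by (intro nn_integral_mono) (auto simp: emeasure_density)
  also have "\<dots> \<le> (\<integral>\<^sup>+ x. g x \<partial>lebesgue)"
    using C by (intro nn_integral_countable_disjoint_le) auto
  finally show ?thesis .
qed

lemma ball_sets_lebesgue [measurable]: "ball c r \<in> sets lebesgue"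
  by simp

lemma superlevel_sets_lebesgue:
  fixes G :: "'a::euclidean_space \<Rightarrow> 'b::linorder_topology"
  assumes "G \<in> borel_measurable lebesgue"
  shows "{x. t < G x} \<in> sets lebesgue"
  using measurable_sets[OF assms borel_open[OF open_greaterThan[of t]]] by (simp add: vimage_def)

lemma lebesgue_ball_scale:
  fixes c :: "'a::euclidean_space"
  assumes "0 < r" "0 < k"
  shows "measure lebesgue (ball c (k * r)) = k ^ DIM('a) * measure lebesgue (ball c r)"
  using assms by (simp add: measure_lebesgue_ball power_mult_distrib)

text \<open>The part of \<open>g\<close> not exceeding \<open>s\<close> adds at most
  \<open>s\<close> to an average, so a ball with average above \<open>2 * s\<close> carries mass at
  least \<open>s * |B|\<close> of the part above \<open>s\<close>. Keeping only that part on the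
  right is what later lets the layers be summed pointwise.\<close>

lemma maximal_function_weak_type:
  fixes g :: "'a::euclidean_space \<Rightarrow> ennreal"
  assumes [measurable]: "g \<in> borel_measurable lebesgue" and s: "0 < s"
  shows "emeasure lebesgue {x. ennreal (2 * s) < maximal_function g x} \<le>
           ennreal (5 ^ DIM('a) / s) * (\<integral>\<^sup>+ x. g x * indicator {x. ennreal s < g x} x \<partial>lebesgue)"
proof -
  let ?n = "DIM('a)"
  let ?h = "\<lambda>x. g x * indicator {x. ennreal s < g x} x"
  have [measurable]: "{x. ennreal s < g x} \<in> sets lebesgue"
    using assms(1) by (rule superlevel_sets_lebesgue)
  define I where "I = (\<integral>\<^sup>+ x. ?h x \<partial>lebesgue)"
  show ?thesis
  proof (cases "I = top")
    case True
    then have "ennreal (5 ^ ?n / s) * I = top" using s by (simp add: ennreal_mult_top)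
    then show ?thesis unfolding I_def by simp
  next
    case False
    define K where "K = {(c::'a, r). 0 < r \<and>
      ennreal (2 * s) < (\<integral>\<^sup>+ y\<in>ball c r. g y \<partial>lebesgue) / emeasure lebesgue (ball c r)}"
    \<comment> \<open>\<open>key\<close> feeds the comparison of measures. \<open>rad\<close>
      supplies the uniform radius bound that Vitali's lemma demands; it follows from
      \<open>s * |B| \<le> I\<close>, which is informative because \<open>I\<close> is finite
      here.\<close>
    have key: "ennreal (s * measure lebesgue (ball c r)) \<le> (\<integral>\<^sup>+ y\<in>ball c r. ?h y \<partial>lebesgue)"
      and rad: "r \<le> max 1 (enn2real I / (s * unit_ball_vol ?n))"
      if "(c, r) \<in> K" for c r
    proof -
      have r: "0 < r" using that unfolding K_def by auto
      define V where "V = measure lebesgue (ball c r)"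
      have V: "0 < V" unfolding V_def using r by (rule measure_lebesgue_ball_pos)
      have eV: "emeasure lebesgue (ball c r) = ennreal V"
        unfolding V_def using r by (intro emeasure_lebesgue_ball_eq_measure) simp
      let ?J = "(\<integral>\<^sup>+ y\<in>ball c r. ?h y \<partial>lebesgue)"
      have "ennreal (2 * s) < (\<integral>\<^sup>+ y\<in>ball c r. g y \<partial>lebesgue) / ennreal V"
        using that unfolding K_def eV[symmetric] by auto
      then have "ennreal (2 * s) * ennreal V \<le> (\<integral>\<^sup>+ y\<in>ball c r. g y \<partial>lebesgue) / ennreal V * ennreal V"
        by (intro mult_right_mono) auto
      also have "\<dots> = (\<integral>\<^sup>+ y\<in>ball c r. g y \<partial>lebesgue)"
        using V by (simp add: ennreal_divide_times)
      also have "\<dots> \<le> (\<integral>\<^sup>+ y. ennreal s * indicator (ball c r) y + ?h y * indicator (ball c r) y \<partial>lebesgue)"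
        by (intro nn_integral_mono) (auto simp: indicator_def not_less)
      also have "\<dots> = ennreal s * ennreal V + ?J"
        by (subst nn_integral_add) (measurable, auto simp: nn_integral_cmult_indicator eV)
      finally have "ennreal (s * V) + ennreal (s * V) \<le> ennreal (s * V) + ?J"
        using s V by (simp add: ennreal_mult[symmetric] ennreal_plus[symmetric] mult_ac del: ennreal_plus)
      then show *: "ennreal (s * V) \<le> ?J" by (simp add: ennreal_add_left_cancel_le)
      have "?J \<le> I" unfolding I_def by (intro nn_integral_mono) (auto simp: indicator_def)
      with * have "ennreal (s * V) \<le> I" by simp
      then have "s * V \<le> enn2real I" using False s V
        by (metis enn2real_ennreal enn2real_mono less_eq_real_def mult_pos_pos top.not_eq_extremum)
      then have "r ^ ?n \<le> enn2real I / (s * unit_ball_vol ?n)"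
        using s r unfolding V_def by (simp add: measure_lebesgue_ball field_simps)
      \<comment> \<open>A bound on the power of \<open>r\<close> controls \<open>r\<close> itself
        only from 1 on, whence the \<open>max 1\<close>.\<close>
      moreover have "r \<le> r ^ ?n" if "1 \<le> r"
        using that self_le_power[of r ?n] by simp
      ultimately show "r \<le> max 1 (enn2real I / (s * unit_ball_vol ?n))"
        by (cases "1 \<le> r") auto
    qed
    let ?E = "{x. ennreal (2 * s) < maximal_function g x}"
    have E: "?E \<in> sets lebesgue"
      by (rule maximal_function_superlevel_sets)
    have "emeasure lebesgue ?E = (\<integral>\<^sup>+ x\<in>?E. 1 \<partial>lebesgue)"
      using E by (simp add: nn_integral_cmult_indicator)
    also have "\<dots> \<le> (\<integral>\<^sup>+ x. ennreal (5 ^ ?n / s) * ?h x \<partial>lebesgue)"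
    proof (rule nn_integral_le_Vitali[where K = K and a = fst and r = snd])
      show "?E \<subseteq> (\<Union>i\<in>K. ball (fst i) (snd i))"
        unfolding less_maximal_function_iff K_def by fastforce
      fix i assume i: "i \<in> K"
      obtain c r where cr: "i = (c, r)" by (cases i)
      have r: "0 < r" using i unfolding K_def cr by auto
      show "0 < snd i \<and> snd i \<le> max 1 (enn2real I / (s * unit_ball_vol ?n))"
        using r rad[of c r] i cr by auto
      have "(\<integral>\<^sup>+ x\<in>ball c (5 * r). 1 \<partial>lebesgue) = ennreal (5 ^ ?n * measure lebesgue (ball c r))"
        using r by (simp add: nn_integral_cmult_indicator emeasure_lebesgue_ball_eq_measure
            lebesgue_ball_scale del: emeasure_completion)
      also have "\<dots> = ennreal (5 ^ ?n / s) * ennreal (s * measure lebesgue (ball c r))"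
        using s by (simp add: ennreal_mult[symmetric])
      also have "\<dots> \<le> ennreal (5 ^ ?n / s) * (\<integral>\<^sup>+ y\<in>ball c r. ?h y \<partial>lebesgue)"
        using key[of c r] i cr by (intro mult_left_mono) auto
      also have "\<dots> = (\<integral>\<^sup>+ y\<in>ball c r. ennreal (5 ^ ?n / s) * ?h y \<partial>lebesgue)"
        by (subst nn_integral_cmult[symmetric]) (auto simp: mult.assoc)
      finally show "(\<integral>\<^sup>+ x\<in>ball (fst i) (5 * snd i). 1 \<partial>lebesgue)
          \<le> (\<integral>\<^sup>+ x\<in>ball (fst i) (snd i). ennreal (5 ^ ?n / s) * ?h x \<partial>lebesgue)"
        using cr by simp
    qed (use E in auto)
    also have "\<dots> = ennreal (5 ^ ?n / s) * (\<integral>\<^sup>+ x. ?h x \<partial>lebesgue)"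
      by (rule nn_integral_cmult) simp
    finally show ?thesis .
  qed
qed

section \<open>Modular boundedness of the maximal function\<close>

lemma young_compose_measurable:
  assumes "young_function \<Phi>" and [measurable]: "G \<in> borel_measurable M" and "\<And>x. 0 \<le> G x"
  shows "(\<lambda>x. \<Phi> (G x)) \<in> borel_measurable M"
proof -
  note young_ext_measurable[OF assms(1), measurable]
  \<comment> \<open>\<open>\<Phi>\<close> is unconstrained at negative arguments and need not be
    measurable on the whole line, so the composition goes through \<open>young_ext\<close>.\<close>
  have "(\<lambda>x. young_ext \<Phi> (ennreal (G x))) \<in> borel_measurable M" by measurable
  then show ?thesis using assms(3) by (simp add: young_ext_ennreal)
qed

lemma powr_int_bracket:
  fixes C y :: real
  assumes "1 < C" "0 < y"
  obtains k :: int where "C powr real_of_int k < y" "y \<le> C powr real_of_int (k + 1)"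
proof
  define k where "k = \<lceil>log C y\<rceil> - 1"
  have "real_of_int k < log C y" "log C y \<le> real_of_int (k + 1)"
    unfolding k_def by linarith+
  then show "C powr real_of_int k < y" "y \<le> C powr real_of_int (k + 1)"
    using assms by (simp_all add: less_log_iff log_le_iff)
qed

text \<open>A discrete substitute for the layer cake formula: the single layer with
  \<open>2 * C powr k < m \<le> 2 * C powr (k + 1)\<close> already dominates. The factor 2 matches
  the threshold \<open>2 * s\<close> of the weak type inequality with
  \<open>s = C powr k\<close>.\<close>

lemma young_ext_le_layers:
  assumes "young_function \<Phi>" "1 < C"
  shows "young_ext \<Phi> m \<le> (\<integral>\<^sup>+ k. \<Phi> (2 * C powr real_of_int (k + 1)) *
           indicator {k. ennreal (2 * C powr real_of_int k) < m} k \<partial>count_space UNIV)"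
    (is "_ \<le> integral\<^sup>N _ ?p")
proof (cases m)
  case (real w)
  show ?thesis
  proof (cases "w = 0")
    case True
    then show ?thesis using real young_zero[OF assms(1)] by (simp add: young_ext_def)
  next
    case False
    then have "0 < w / 2" using real by simp
    then obtain k where k: "C powr real_of_int k < w / 2" "w / 2 \<le> C powr real_of_int (k + 1)"
      by (rule powr_int_bracket[OF assms(2)])
    have "young_ext \<Phi> m \<le> \<Phi> (2 * C powr real_of_int (k + 1))"
      using real k by (auto simp: young_ext_ennreal intro!: young_mono[OF assms(1)])
    also have "\<dots> = ?p k" using real k by (simp add: ennreal_less_iff)
    also have "\<dots> \<le> integral\<^sup>N (count_space UNIV) ?p" by (rule nn_integral_ge_point) simp
    finally show ?thesis .
  qed
next
  case top
  \<comment> \<open>For \<open>m = \<infinity>\<close> every layer is present, and the coefficients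
    are unbounded as \<open>k\<close> grows because \<open>\<Phi>\<close> tends to
    \<infinity>.\<close>
  have "ennreal N < integral\<^sup>N (count_space UNIV) ?p" for N
  proof -
    obtain r where r: "0 \<le> r" "ennreal N < \<Phi> r"
      using young_inverse_set_nonempty[OF assms(1)] by blast
    obtain k where k: "r + 1 \<le> C powr real_of_int (k + 1)"
      using powr_int_bracket[OF assms(2), of "r + 1"] r by (metis add_nonneg_pos zero_less_one)
    have "ennreal N < \<Phi> r" by fact
    also have "\<dots> \<le> \<Phi> (2 * C powr real_of_int (k + 1))"
      using r k by (intro young_mono[OF assms(1)]) auto
    also have "\<dots> = ?p k" using top by simp
    also have "\<dots> \<le> integral\<^sup>N (count_space UNIV) ?p" by (rule nn_integral_ge_point) simp
    finally show ?thesis .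
  qed
  then have "integral\<^sup>N (count_space UNIV) ?p = top"
    by (cases "integral\<^sup>N (count_space UNIV) ?p") auto
  then show ?thesis by simp
qed

lemma nabla2_iterate:
  assumes "\<forall>r\<ge>0. \<Phi> r \<le> ennreal (1 / (2 * C)) * \<Phi> (C * r)" "1 < C" "0 \<le> r"
  shows "\<Phi> r \<le> ennreal ((1 / (2 * C)) ^ j) * \<Phi> (C ^ j * r)"
proof (induction j)
  case (Suc j)
  have "\<Phi> r \<le> ennreal ((1 / (2 * C)) ^ j) * \<Phi> (C ^ j * r)" by fact
  also have "\<dots> \<le> ennreal ((1 / (2 * C)) ^ j) * (ennreal (1 / (2 * C)) * \<Phi> (C * (C ^ j * r)))"
    using assms by (intro mult_left_mono assms(1)[rule_format]) auto
  also have "\<dots> = ennreal ((1 / (2 * C)) ^ Suc j) * \<Phi> (C ^ Suc j * r)"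
    using assms(2) by (simp add: mult.assoc[symmetric] ennreal_mult[symmetric] mult.commute)
  finally show ?case .
qed simp

text \<open>The pointwise sum left over after the weak type inequality has been applied in each
  layer. Going \<open>j\<close> layers down from the top one multiplies the weight
  \<open>y / C powr k\<close> by \<open>C ^ j\<close>, while \<open>nabla2_iterate\<close> gains
  \<open>(1 / (2 * C)) ^ j\<close>. The net factor \<open>(1 / 2) ^ j\<close> is summable.\<close>

lemma nabla2_layer_sum:
  assumes \<Phi>: "young_function \<Phi>"
    and nabla: "\<forall>r\<ge>0. \<Phi> r \<le> ennreal (1 / (2 * C)) * \<Phi> (C * r)" and C: "1 < C" and y: "0 \<le> y"
  shows "(\<integral>\<^sup>+ k. ennreal (y / C powr real_of_int k) * \<Phi> (2 * C powr real_of_int (k + 1)) *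
           indicator {k. C powr real_of_int k < y} k \<partial>count_space UNIV) \<le> ennreal (2 * C) * \<Phi> (2 * C * y)"
proof (cases "y = 0")
  case True
  have "\<not> C powr real_of_int k < 0" for k by (simp add: not_less)
  then show ?thesis using True by simp
next
  case False
  with y have "0 < y" by simp
  \<comment> \<open>\<open>K\<close> is the highest layer in the sum, since
    \<open>C powr k < y\<close> forces \<open>k \<le> K\<close>. The upper bound on \<open>y\<close>
    costs the factor \<open>C\<close> in \<open>?c\<close>.\<close>
  then obtain K where K: "C powr real_of_int K < y" "y \<le> C powr real_of_int (K + 1)"
    by (rule powr_int_bracket[OF C])
  let ?q = "\<lambda>k::int. C powr real_of_int k"
  have q1: "?q (k + 1) = C * ?q k" for k using C by (simp add: powr_add)
  let ?c = "ennreal C * \<Phi> (2 * C * y)"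
  have step: "ennreal (y / ?q (K - int j)) * \<Phi> (2 * ?q (K - int j + 1)) \<le> ennreal ((1 / 2) ^ j) * ?c" for j
  proof -
    have qj: "?q (K - int j) = ?q K / C ^ j"
      using C by (simp add: powr_diff powr_realpow)
    have "\<Phi> (2 * ?q (K - int j + 1)) \<le> ennreal ((1 / (2 * C)) ^ j) * \<Phi> (C ^ j * (2 * ?q (K - int j + 1)))"
      by (rule nabla2_iterate[OF nabla C]) auto
    also have "C ^ j * (2 * ?q (K - int j + 1)) = 2 * C * ?q K"
      unfolding q1 qj using C by simp
    also have "ennreal ((1 / (2 * C)) ^ j) * \<Phi> (2 * C * ?q K) \<le> ennreal ((1 / (2 * C)) ^ j) * \<Phi> (2 * C * y)"
      using C K by (intro mult_left_mono young_mono[OF \<Phi>]) auto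
    finally have "ennreal (y / ?q (K - int j)) * \<Phi> (2 * ?q (K - int j + 1))
       \<le> ennreal (y / ?q (K - int j)) * (ennreal ((1 / (2 * C)) ^ j) * \<Phi> (2 * C * y))"
      by (rule mult_left_mono) simp
    also have "\<dots> = ennreal (y / ?q (K - int j) * (1 / (2 * C)) ^ j) * \<Phi> (2 * C * y)"
      using C y by (subst ennreal_mult) (simp_all add: mult.assoc)
    also have "\<dots> \<le> ennreal ((1 / 2) ^ j * C) * \<Phi> (2 * C * y)"
    proof (intro mult_right_mono ennreal_leI)
      have "y / ?q (K - int j) * (1 / (2 * C)) ^ j = (1 / 2) ^ j * (y / ?q K)"
        unfolding qj using C by (simp add: field_simps power_mult_distrib)
      also have "\<dots> \<le> (1 / 2) ^ j * C"
        using K(2) C unfolding q1 by (intro mult_left_mono) (auto simp: field_simps)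
      finally show "y / ?q (K - int j) * (1 / (2 * C)) ^ j \<le> (1 / 2) ^ j * C" .
    qed simp
    also have "\<dots> = ennreal ((1 / 2) ^ j) * ?c"
      using C by (simp add: ennreal_mult mult.assoc)
    finally show ?thesis .
  qed
  have bij: "bij_betw (\<lambda>j. K - int j) UNIV {..K}"
    by (rule bij_betwI[where g = "\<lambda>k. nat (K - k)"]) auto
  have "k \<le> K" if "?q k < y" for k
  proof -
    have "?q k < ?q (K + 1)" using that K by simp
    then have "real_of_int k < real_of_int (K + 1)" using C powr_less_cancel_iff by blast
    then show ?thesis by linarith
  qed
  then have "(\<integral>\<^sup>+ k. ennreal (y / ?q k) * \<Phi> (2 * ?q (k + 1)) * indicator {k. ?q k < y} k \<partial>count_space UNIV)
      \<le> (\<integral>\<^sup>+ k. ennreal (y / ?q k) * \<Phi> (2 * ?q (k + 1)) * indicator {..K} k \<partial>count_space UNIV)"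
    by (intro nn_integral_mono) (auto simp: indicator_def)
  also have "\<dots> = (\<integral>\<^sup>+ k. ennreal (y / ?q k) * \<Phi> (2 * ?q (k + 1)) \<partial>count_space {..K})"
    by (rule nn_integral_count_space_indicator[symmetric]) simp
  also have "\<dots> = (\<integral>\<^sup>+ j. ennreal (y / ?q (K - int j)) * \<Phi> (2 * ?q (K - int j + 1)) \<partial>count_space UNIV)"
    by (rule nn_integral_bij_count_space[OF bij, symmetric])
  also have "\<dots> \<le> (\<integral>\<^sup>+ j. ennreal ((1 / 2) ^ j) * ?c \<partial>count_space UNIV)"
    using step by (rule nn_integral_mono)
  also have "\<dots> = (\<Sum>j. ennreal ((1 / 2) ^ j)) * ?c"
    by (simp add: nn_integral_multc nn_integral_count_space_nat)
  also have "(\<Sum>j. ennreal ((1 / 2) ^ j)) = ennreal 2"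
    using geometric_sums[of "1/2::real"] by (intro suminf_ennreal_eq) auto
  also have "ennreal 2 * ?c = ennreal (2 * C) * \<Phi> (2 * C * y)"
    using C by (simp add: ennreal_mult mult.assoc)
  finally show ?thesis .
qed

text \<open>Tonelli is applied twice: once to integrate each layer of the maximal function and
  invoke the weak type inequality, once to return to a sum over layers at fixed \<open>x\<close>,
  which \<open>nabla2_layer_sum\<close> evaluates.\<close>

lemma maximal_function_modular:
  fixes G :: "'a::euclidean_space \<Rightarrow> real"
  assumes \<Phi>: "young_function \<Phi>"
    and nabla: "\<forall>r\<ge>0. \<Phi> r \<le> ennreal (1 / (2 * C)) * \<Phi> (C * r)" and C: "1 < C"
    and [measurable]: "G \<in> borel_measurable lebesgue" and G: "\<And>x. 0 \<le> G x"
  shows "(\<integral>\<^sup>+ x. young_ext \<Phi> (maximal_function (\<lambda>x. ennreal (G x)) x) \<partial>lebesgue)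
           \<le> ennreal (5 ^ DIM('a) * (2 * C)) * (\<integral>\<^sup>+ x. \<Phi> (2 * C * G x) \<partial>lebesgue)"
proof -
  let ?q = "\<lambda>k::int. C powr real_of_int k"
  let ?M = "maximal_function (\<lambda>x. ennreal (G x))"
  let ?A = "5 ^ DIM('a) :: real"
  have q: "0 < ?q k" for k using C by simp
  define E where "E k = {x. ennreal (2 * ?q k) < ?M x}" for k
  define P where "P k = {x. ?q k < G x}" for k
  define a where "a k = \<Phi> (2 * ?q (k + 1))" for k
  have E [measurable]: "E k \<in> sets lebesgue" for k
    unfolding E_def by (rule maximal_function_superlevel_sets)
  have P [measurable]: "P k \<in> sets lebesgue" for k
    unfolding P_def by (rule superlevel_sets_lebesgue) fact
  have weak: "emeasure lebesgue (E k) \<le> ennreal (?A / ?q k) * (\<integral>\<^sup>+ x. ennreal (G x) * indicator (P k) x \<partial>lebesgue)" for k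
  proof -
    have "P k = {x. ennreal (?q k) < ennreal (G x)}"
      unfolding P_def using q[of k] by (auto simp: ennreal_less_iff)
    then show ?thesis unfolding E_def using q by (simp only:) (rule maximal_function_weak_type, auto)
  qed
  have "(\<integral>\<^sup>+ x. young_ext \<Phi> (?M x) \<partial>lebesgue) \<le>
     (\<integral>\<^sup>+ x. (\<integral>\<^sup>+ k. a k * indicator (E k) x \<partial>count_space UNIV) \<partial>lebesgue)"
  proof (rule nn_integral_mono)
    fix x
    have "indicator (E k) x = (indicator {k. ennreal (2 * ?q k) < ?M x} k :: ennreal)" for k
      by (simp add: E_def indicator_def)
    then show "young_ext \<Phi> (?M x) \<le> (\<integral>\<^sup>+ k. a k * indicator (E k) x \<partial>count_space UNIV)"
      using young_ext_le_layers[OF \<Phi> C, of "?M x"] by (simp only: a_def)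
  qed
  also have "\<dots> = (\<integral>\<^sup>+ k. (\<integral>\<^sup>+ x. a k * indicator (E k) x \<partial>lebesgue) \<partial>count_space UNIV)"
    by (rule nn_integral_count_space_nn_integral) measurable
  also have "\<dots> = (\<integral>\<^sup>+ k. a k * emeasure lebesgue (E k) \<partial>count_space UNIV)"
    by (intro nn_integral_cong nn_integral_cmult_indicator E)
  also have "\<dots> \<le> (\<integral>\<^sup>+ k. a k * (ennreal (?A / ?q k) *
       (\<integral>\<^sup>+ x. ennreal (G x) * indicator (P k) x \<partial>lebesgue)) \<partial>count_space UNIV)"
    by (intro nn_integral_mono mult_left_mono weak) simp
  also have "\<dots> = (\<integral>\<^sup>+ k. (\<integral>\<^sup>+ x. ennreal ?A * (ennreal (G x / ?q k) * a k * indicator (P k) x)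
       \<partial>lebesgue) \<partial>count_space UNIV)"
  proof (rule nn_integral_cong)
    fix k :: int
    have "a k * (ennreal (?A / ?q k) * (\<integral>\<^sup>+ x. ennreal (G x) * indicator (P k) x \<partial>lebesgue)) =
       (\<integral>\<^sup>+ x. a k * ennreal (?A / ?q k) * (ennreal (G x) * indicator (P k) x) \<partial>lebesgue)"
      by (subst nn_integral_cmult) (measurable, simp only: mult.assoc)
    also have "\<dots> = (\<integral>\<^sup>+ x. ennreal ?A * (ennreal (G x / ?q k) * a k * indicator (P k) x) \<partial>lebesgue)"
    proof (rule nn_integral_cong)
      fix x
      have "ennreal (?A / ?q k) * ennreal (G x) = ennreal ?A * ennreal (G x / ?q k)"
        using G[of x] q[of k] by (simp add: ennreal_mult[symmetric] del: ennreal_power)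
      then have "a k * (ennreal (?A / ?q k) * ennreal (G x)) * indicator (P k) x
         = a k * (ennreal ?A * ennreal (G x / ?q k)) * indicator (P k) x" by (simp only:)
      then show "a k * ennreal (?A / ?q k) * (ennreal (G x) * indicator (P k) x)
         = ennreal ?A * (ennreal (G x / ?q k) * a k * indicator (P k) x)"
        by (simp only: mult_ac)
    qed
    finally show "a k * (ennreal (?A / ?q k) * (\<integral>\<^sup>+ x. ennreal (G x) * indicator (P k) x \<partial>lebesgue)) =
       (\<integral>\<^sup>+ x. ennreal ?A * (ennreal (G x / ?q k) * a k * indicator (P k) x) \<partial>lebesgue)" .
  qed
  also have "\<dots> = (\<integral>\<^sup>+ x. (\<integral>\<^sup>+ k. ennreal ?A * (ennreal (G x / ?q k) * a k * indicator (P k) x)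
       \<partial>count_space UNIV) \<partial>lebesgue)"
    by (rule nn_integral_count_space_nn_integral[symmetric]) measurable
  also have "\<dots> \<le> (\<integral>\<^sup>+ x. ennreal (?A * (2 * C)) * \<Phi> (2 * C * G x) \<partial>lebesgue)"
  proof (rule nn_integral_mono)
    fix x
    have "indicator (P k) x = (indicator {k. ?q k < G x} k :: ennreal)" for k
      by (simp add: P_def indicator_def)
    then have "(\<integral>\<^sup>+ k. ennreal ?A * (ennreal (G x / ?q k) * a k * indicator (P k) x) \<partial>count_space UNIV)
      = ennreal ?A * (\<integral>\<^sup>+ k. ennreal (G x / ?q k) * \<Phi> (2 * ?q (k + 1)) * indicator {k. ?q k < G x} k \<partial>count_space UNIV)"
      unfolding a_def by (simp only:) (rule nn_integral_cmult, simp)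
    also have "\<dots> \<le> ennreal ?A * (ennreal (2 * C) * \<Phi> (2 * C * G x))"
      by (intro mult_left_mono nabla2_layer_sum[OF \<Phi> nabla C G]) auto
    also have "\<dots> = ennreal (?A * (2 * C)) * \<Phi> (2 * C * G x)"
      using C by (subst ennreal_mult) (auto simp: mult.assoc)
    finally show "(\<integral>\<^sup>+ k. ennreal ?A * (ennreal (G x / ?q k) * a k * indicator (P k) x) \<partial>count_space UNIV)
      \<le> ennreal (?A * (2 * C)) * \<Phi> (2 * C * G x)" .
  qed
  also have "\<dots> = ennreal (?A * (2 * C)) * (\<integral>\<^sup>+ x. \<Phi> (2 * C * G x) \<partial>lebesgue)"
    using C G by (intro nn_integral_cmult young_compose_measurable[OF \<Phi>]) auto
  finally show ?thesis .
qed

text \<open>The constants of the modular inequality are absorbed by scaling. Dividing by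
  \<open>2 * C\<close> removes the dilation of the argument; dividing further by \<open>D\<close>
  removes the outer constant, as convexity gives \<open>\<Phi> (y / D) \<le> \<Phi> y / D\<close>.
  The resulting \<open>K\<close> does not depend on \<open>F\<close>.\<close>

lemma maximal_function_orlicz:
  assumes \<Phi>: "young_function \<Phi>" and "nabla2 \<Phi>"
  obtains K :: real where "1 \<le> K"
    "\<And>F :: 'a::euclidean_space \<Rightarrow> real. F \<in> borel_measurable lebesgue \<Longrightarrow> (\<And>x. 0 \<le> F x) \<Longrightarrow>
       (\<integral>\<^sup>+ x. \<Phi> (F x) \<partial>lebesgue) \<le> 1 \<Longrightarrow>
       (\<integral>\<^sup>+ x. young_ext \<Phi> (maximal_function (\<lambda>x. ennreal (F x / K)) x) \<partial>lebesgue) \<le> 1"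
proof -
  obtain C where C: "1 < C" and nabla: "\<forall>r\<ge>0. \<Phi> r \<le> ennreal (1 / (2 * C)) * \<Phi> (C * r)"
    using assms(2) unfolding nabla2_def by auto
  let ?A = "5 ^ DIM('a) :: real"
  define D where "D = ?A * (2 * C)"
  define K where "K = D * (2 * C)"
  have "1 \<le> ?A" by simp
  then have D: "1 \<le> D" unfolding D_def using C mult_mono[of 1 ?A 1 "2 * C"] by auto
  then have K: "1 \<le> K" unfolding K_def using C mult_mono[of 1 D 1 "2 * C"] by auto
  show thesis
  proof (rule that[OF K])
    fix F :: "'a \<Rightarrow> real"
    assume [measurable]: "F \<in> borel_measurable lebesgue" and F: "\<And>x. 0 \<le> F x"
      and le1: "(\<integral>\<^sup>+ x. \<Phi> (F x) \<partial>lebesgue) \<le> 1"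
    have "(\<integral>\<^sup>+ x. young_ext \<Phi> (maximal_function (\<lambda>x. ennreal (F x / K)) x) \<partial>lebesgue)
       \<le> ennreal D * (\<integral>\<^sup>+ x. \<Phi> (2 * C * (F x / K)) \<partial>lebesgue)"
      unfolding D_def using F K by (intro maximal_function_modular[OF \<Phi> nabla C]) auto
    also have "\<dots> \<le> ennreal D * (\<integral>\<^sup>+ x. ennreal (1 / D) * \<Phi> (F x) \<partial>lebesgue)"
    proof (intro mult_left_mono nn_integral_mono)
      fix x
      have "2 * C * (F x / K) = (1 / D) * F x" unfolding K_def using C by simp
      then show "\<Phi> (2 * C * (F x / K)) \<le> ennreal (1 / D) * \<Phi> (F x)"
        using young_scale[OF \<Phi> F, of "1 / D" x] D by simp
    qed simp
    also have "\<dots> = ennreal D * ennreal (1 / D) * (\<integral>\<^sup>+ x. \<Phi> (F x) \<partial>lebesgue)"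
      using F by (subst nn_integral_cmult) (auto simp: mult.assoc intro: young_compose_measurable[OF \<Phi>])
    also have "ennreal D * ennreal (1 / D) = 1" using D by (simp add: ennreal_mult[symmetric])
    finally show "(\<integral>\<^sup>+ x. young_ext \<Phi> (maximal_function (\<lambda>x. ennreal (F x / K)) x) \<partial>lebesgue) \<le> 1"
      using le1 by simp
  qed
qed

section \<open>Sufficiency\<close>

lemma locally_integrable_measurable:
  fixes f :: "real^'n \<Rightarrow> real"
  assumes "locally_integrable f"
  shows "f \<in> borel_measurable lebesgue"
proof (rule borel_measurable_LIMSEQ_real)
  fix x :: "real^'n"
  obtain N where N: "norm x \<le> real N" using real_arch_simple by blast
  show "(\<lambda>k. indicator (cball 0 (real k)) x *\<^sub>R f x) \<longlonglongrightarrow> f x"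
  proof (rule tendsto_eventually)
    show "eventually (\<lambda>k. indicator (cball 0 (real k)) x *\<^sub>R f x = f x) sequentially"
      using eventually_ge_at_top[of N] by eventually_elim (use N in auto)
  qed
next
  fix k
  show "(\<lambda>x. indicator (cball 0 (real k)) x *\<^sub>R f x) \<in> borel_measurable lebesgue"
    using assms unfolding locally_integrable_def set_integrable_def
    by (intro borel_measurable_integrable) auto
qed

text \<open>A form of the Hoelder inequality against the indicator of \<open>S\<close>, up to a
  constant. The argument \<open>u\<close> lies strictly above the inverse because
  \<open>\<Phi> u > 1 / V\<close> is required, whereas at the inverse itself only the opposite
  inequality is certain.\<close>

lemma nn_integral_le_above_young_inverse:
  assumes \<Phi>: "young_function \<Phi>" and [measurable]: "S \<in> sets M" "g \<in> borel_measurable M"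
    and V: "emeasure M S = ennreal V" "0 < V"
    and le1: "(\<integral>\<^sup>+ x\<in>S. young_ext \<Phi> (g x) \<partial>M) \<le> 1"
    and u: "young_inverse \<Phi> (1 / V) < u"
  shows "(\<integral>\<^sup>+ x\<in>S. g x \<partial>M) \<le> ennreal (2 * u * V)"
proof -
  note young_ext_measurable[OF \<Phi>, measurable]
  have u0: "0 \<le> u" using u young_inverse_nonneg[OF \<Phi>, of "1 / V"] by simp
  have "(\<integral>\<^sup>+ x\<in>S. g x \<partial>M) \<le> (\<integral>\<^sup>+ x. ennreal u * indicator S x +
      ennreal (u * V) * (young_ext \<Phi> (g x) * indicator S x) \<partial>M)"
    using young_ext_linear_bound[OF \<Phi> V(2) young_above_inverse[OF \<Phi> u] u0]
    by (intro nn_integral_mono) (auto simp: indicator_def)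
  also have "\<dots> = ennreal u * ennreal V + ennreal (u * V) * (\<integral>\<^sup>+ x\<in>S. young_ext \<Phi> (g x) \<partial>M)"
    by (subst nn_integral_add) (measurable, simp add: nn_integral_cmult_indicator nn_integral_cmult V)
  also have "\<dots> \<le> ennreal u * ennreal V + ennreal (u * V) * 1"
    using le1 by (intro add_left_mono mult_left_mono) auto
  also have "\<dots> = ennreal (2 * u * V)"
    using u0 V(2) by (simp add: ennreal_mult[symmetric] ennreal_plus[symmetric] mult_ac del: ennreal_plus)
  finally show ?thesis .
qed

text \<open>With \<open>V\<close> the measure of the ball, the integral over it is at most
  \<open>m * V\<close> and at most \<open>4 * young_inverse \<Phi> (1 / V) * V\<close>. For
  \<open>\<Phi> m \<le> 1 / V\<close> the first bound,
  \<open>m \<le> young_inverse \<Phi> (\<Phi> m)\<close> and the hypothesis at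
  \<open>t = \<Phi> m\<close> suffice. Otherwise the second bound, the hypothesis at
  \<open>t = 1 / V\<close> and monotonicity of the inverse of \<open>\<Psi>\<close> do.\<close>

lemma hedberg_orlicz:
  fixes G :: "'a::euclidean_space \<Rightarrow> real"
  assumes \<Phi>: "young_function \<Phi>" and \<Psi>: "young_function \<Psi>" and Y: "\<And>r. 0 < r \<Longrightarrow> 0 < \<Phi> r \<and> \<Phi> r < \<infinity>"
    and C: "0 < C" "\<And>t. 0 < t \<Longrightarrow> t powr (- e) * young_inverse \<Phi> t \<le> C * young_inverse \<Psi> t"
    and e: "0 \<le> e"
    and [measurable]: "G \<in> borel_measurable lebesgue" and G: "\<And>x. 0 \<le> G x"
    and le1: "(\<integral>\<^sup>+ x. \<Phi> (G x) \<partial>lebesgue) \<le> 1"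
    and r: "0 < r" "x \<in> ball c r"
    and m: "maximal_function (\<lambda>x. ennreal (G x)) x = ennreal m" "0 \<le> m"
  shows "ennreal (measure lebesgue (ball c r) powr (e - 1)) * (\<integral>\<^sup>+ y\<in>ball c r. ennreal (G y) \<partial>lebesgue)
           \<le> ennreal (4 * C * young_inverse \<Psi> (enn2real (\<Phi> m)))"
proof -
  define V where "V = measure lebesgue (ball c r)"
  have V: "0 < V" unfolding V_def using r by (intro measure_lebesgue_ball_pos)
  have eV: "emeasure lebesgue (ball c r) = ennreal V"
    unfolding V_def using r by (intro emeasure_lebesgue_ball_eq_measure) simp
  let ?J = "\<integral>\<^sup>+ y\<in>ball c r. ennreal (G y) \<partial>lebesgue"
  have "?J / ennreal V \<le> ennreal m"
    using average_le_maximal_function[OF r] m by (metis eV)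
  then have "?J / ennreal V * ennreal V \<le> ennreal m * ennreal V" by (rule mult_right_mono) simp
  then have "?J \<le> ennreal (m * V)" using V m by (simp add: ennreal_divide_times ennreal_mult)
  then obtain j where j: "?J = ennreal j" "0 \<le> j" "j \<le> m * V"
    using V m by (cases ?J) (auto simp: top_unique)
  let ?t = "1 / V"
  have t: "0 < ?t" using V by simp
  have pos: "0 < young_inverse \<Phi> ?t" using \<Phi> t by (rule young_inverse_pos)
  have "(\<integral>\<^sup>+ x\<in>ball c r. young_ext \<Phi> (ennreal (G x)) \<partial>lebesgue) \<le> (\<integral>\<^sup>+ x. \<Phi> (G x) \<partial>lebesgue)"
    using G by (intro nn_integral_mono) (auto simp: indicator_def young_ext_ennreal)
  with le1 have "(\<integral>\<^sup>+ x\<in>ball c r. young_ext \<Phi> (ennreal (G x)) \<partial>lebesgue) \<le> 1" by simp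
  \<comment> \<open>Doubling a positive inverse gives an admissible \<open>u\<close> strictly above
    it.\<close>
  then have "?J \<le> ennreal (2 * (2 * young_inverse \<Phi> ?t) * V)"
    using pos by (intro nn_integral_le_above_young_inverse[OF \<Phi> _ _ eV V]) auto
  then have j2: "j \<le> 4 * young_inverse \<Phi> ?t * V"
    using j V pos by (simp add: ennreal_le_iff)
  have Vpow: "V powr (e - 1) * (k * V) = k * V powr e" for k
    using V by (simp add: powr_diff)
  have "V powr (e - 1) * j \<le> 4 * C * young_inverse \<Psi> (enn2real (\<Phi> m))"
  proof (cases "m = 0")
    case True
    then have "j = 0" using j by simp
    then show ?thesis using C(1) young_inverse_nonneg[OF \<Psi>] by simp
  next
    case False
    define s where "s = enn2real (\<Phi> m)"
    have Ym: "0 < \<Phi> m" "\<Phi> m < \<infinity>" using Y[of m] False m by auto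
    have s: "0 < s" "\<Phi> m = ennreal s"
      using Ym unfolding s_def by (auto simp: enn2real_positive_iff)
    have m_le: "m \<le> young_inverse \<Phi> s" using s m by (intro le_young_inverse[OF \<Phi>]) auto
    show ?thesis
    proof (cases "s \<le> ?t")
      case True
      have "V powr (e - 1) * j \<le> V powr (e - 1) * (m * V)"
        using j by (intro mult_left_mono) auto
      also have "\<dots> = m * V powr e" by (rule Vpow)
      also have "\<dots> \<le> young_inverse \<Phi> s * (1 / s) powr e"
        using m_le m e V s True by (intro mult_mono powr_mono2) (auto simp: field_simps)
      also have "\<dots> = s powr (- e) * young_inverse \<Phi> s"
        using s by (simp add: powr_minus powr_divide field_simps)
      also have "\<dots> \<le> C * young_inverse \<Psi> s" using C(2)[OF s(1)] .
      also have "\<dots> \<le> 4 * C * young_inverse \<Psi> s"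
        using C(1) young_inverse_nonneg[OF \<Psi>, of s] by (intro mult_right_mono) auto
      finally show ?thesis unfolding s_def .
    next
      case False
      have "V powr (e - 1) * j \<le> V powr (e - 1) * (4 * young_inverse \<Phi> ?t * V)"
        using j2 by (intro mult_left_mono) auto
      also have "\<dots> = 4 * young_inverse \<Phi> ?t * V powr e" by (rule Vpow)
      also have "\<dots> = 4 * (?t powr (- e) * young_inverse \<Phi> ?t)"
        using V by (simp add: powr_minus powr_divide field_simps)
      also have "\<dots> \<le> 4 * (C * young_inverse \<Psi> ?t)" using C(2)[OF t] by simp
      also have "\<dots> \<le> 4 * (C * young_inverse \<Psi> s)"
        using C(1) young_inverse_mono[OF \<Psi>, of ?t s] False by simp
      finally show ?thesis unfolding s_def by simp
    qed
  qed
  then have "ennreal (V powr (e - 1) * j) \<le> ennreal (4 * C * young_inverse \<Psi> (enn2real (\<Phi> m)))"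
    by (rule ennreal_leI)
  then show ?thesis unfolding j(1) V_def[symmetric] using j(2) by (simp add: ennreal_mult)
qed

text \<open>Two points of the ball are less than \<open>2 * r\<close> apart, and a power \<beta> of
  the radius is a multiple of the power \<beta>/n of the volume. The Hoelder bound thus raises the
  order of the fractional average from \<alpha> to \<alpha> + \<beta>. Equality of \<open>b\<close>
  and \<open>b'\<close> is needed at the point \<open>x\<close> itself, since \<open>b x\<close>
  enters every average.\<close>

lemma commutator_average_le:
  fixes b b' f :: "real^'n \<Rightarrow> real"
  assumes ae: "AE y in lebesgue. b y = b' y" and x: "b x = b' x"
    and lip: "\<And>x y. \<bar>b' x - b' y\<bar> \<le> L * norm (x - y) powr \<beta>" and L: "0 \<le> L" and \<beta>: "0 < \<beta>"
    and [measurable]: "f \<in> borel_measurable lebesgue"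
    and r: "0 < r" "x \<in> ball c r"
  shows "ennreal (measure lebesgue (ball c r) powr (-1 + \<alpha> / real CARD('n))) *
          (\<integral>\<^sup>+ y\<in>ball c r. ennreal (\<bar>b x - b y\<bar> * \<bar>f y\<bar>) \<partial>lebesgue)
    \<le> ennreal (L * (2 powr \<beta> * unit_ball_vol (real CARD('n)) powr (- (\<beta> / real CARD('n))))) *
        (ennreal (measure lebesgue (ball c r) powr ((\<alpha> + \<beta>) / real CARD('n) - 1)) *
         (\<integral>\<^sup>+ y\<in>ball c r. ennreal \<bar>f y\<bar> \<partial>lebesgue))"
proof -
  let ?n = "real CARD('n)" and ?v = "unit_ball_vol (real CARD('n))"
  define V where "V = measure lebesgue (ball c r)"
  have V: "0 < V" unfolding V_def using r by (intro measure_lebesgue_ball_pos)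
  have v: "0 < ?v" by simp
  have Vr: "V = ?v * r powr ?n" unfolding V_def using r by (simp add: measure_lebesgue_ball powr_realpow)
  have rad: "(2 * r) powr \<beta> = 2 powr \<beta> * ?v powr (- (\<beta> / ?n)) * V powr (\<beta> / ?n)"
    unfolding Vr using r less_imp_neq[OF v] by (simp add: powr_mult powr_powr powr_minus)
  have pt: "\<bar>b x - b y\<bar> \<le> L * (2 * r) powr \<beta>" if "y \<in> ball c r" "b y = b' y" for y
  proof -
    have "norm (x - y) \<le> 2 * r"
      using that(1) r(2) dist_triangle2[of x y c] by (auto simp: dist_norm norm_minus_commute)
    then have "norm (x - y) powr \<beta> \<le> (2 * r) powr \<beta>" using \<beta> by (intro powr_mono2) auto
    then have "L * norm (x - y) powr \<beta> \<le> L * (2 * r) powr \<beta>" using L by (rule mult_left_mono)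
    with lip[of x y] show ?thesis using x that(2) by simp
  qed
  have "(\<integral>\<^sup>+ y\<in>ball c r. ennreal (\<bar>b x - b y\<bar> * \<bar>f y\<bar>) \<partial>lebesgue)
      \<le> (\<integral>\<^sup>+ y. ennreal (L * (2 * r) powr \<beta>) * (ennreal \<bar>f y\<bar> * indicator (ball c r) y) \<partial>lebesgue)"
  proof (rule nn_integral_mono_AE)
    show "AE y in lebesgue. ennreal (\<bar>b x - b y\<bar> * \<bar>f y\<bar>) * indicator (ball c r) y \<le>
        ennreal (L * (2 * r) powr \<beta>) * (ennreal \<bar>f y\<bar> * indicator (ball c r) y)"
      using ae
    proof eventually_elim
      case (elim y)
      show ?case
      proof (cases "y \<in> ball c r")
        case True
        have "ennreal (\<bar>b x - b y\<bar> * \<bar>f y\<bar>) \<le> ennreal ((L * (2 * r) powr \<beta>) * \<bar>f y\<bar>)"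
          using pt[OF True elim] by (intro ennreal_leI mult_right_mono) auto
        then show ?thesis using True L by (simp add: ennreal_mult)
      qed simp
    qed
  qed
  also have "\<dots> = ennreal (L * (2 * r) powr \<beta>) * (\<integral>\<^sup>+ y\<in>ball c r. ennreal \<bar>f y\<bar> \<partial>lebesgue)"
    by (rule nn_integral_cmult) measurable
  finally have "ennreal (V powr (-1 + \<alpha> / ?n)) * (\<integral>\<^sup>+ y\<in>ball c r. ennreal (\<bar>b x - b y\<bar> * \<bar>f y\<bar>) \<partial>lebesgue)
      \<le> ennreal (V powr (-1 + \<alpha> / ?n)) * (ennreal (L * (2 * r) powr \<beta>) * (\<integral>\<^sup>+ y\<in>ball c r. ennreal \<bar>f y\<bar> \<partial>lebesgue))"
    by (rule mult_left_mono) simp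
  also have "\<dots> = ennreal (V powr (-1 + \<alpha> / ?n) * (L * (2 * r) powr \<beta>)) * (\<integral>\<^sup>+ y\<in>ball c r. ennreal \<bar>f y\<bar> \<partial>lebesgue)"
    using L by (subst ennreal_mult) (auto simp: mult.assoc)
  also have "V powr (-1 + \<alpha> / ?n) * (L * (2 * r) powr \<beta>)
      = (L * (2 powr \<beta> * ?v powr (- (\<beta> / ?n)))) * V powr ((\<alpha> + \<beta>) / ?n - 1)"
  proof -
    have "V powr ((\<alpha> + \<beta>) / ?n - 1) = V powr (-1 + \<alpha> / ?n) * V powr (\<beta> / ?n)"
      unfolding powr_add[symmetric] by (simp add: add_divide_distrib algebra_simps)
    then show ?thesis unfolding rad by simp
  qed
  also have "ennreal ((L * (2 powr \<beta> * ?v powr (- (\<beta> / ?n)))) * V powr ((\<alpha> + \<beta>) / ?n - 1)) * (\<integral>\<^sup>+ y\<in>ball c r. ennreal \<bar>f y\<bar> \<partial>lebesgue)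
      = ennreal (L * (2 powr \<beta> * ?v powr (- (\<beta> / ?n)))) * (ennreal (V powr ((\<alpha> + \<beta>) / ?n - 1)) * (\<integral>\<^sup>+ y\<in>ball c r. ennreal \<bar>f y\<bar> \<partial>lebesgue))"
    using L by (subst ennreal_mult) (auto simp: mult.assoc)
  finally show ?thesis unfolding V_def .
qed

lemma orlicz_norm_le:
  assumes "0 < l" "(\<integral>\<^sup>+ x. young_ext \<Phi> (g x / ennreal l) \<partial>lebesgue) \<le> 1"
  shows "orlicz_norm \<Phi> g \<le> ennreal l"
  unfolding orlicz_norm_def using assms by (intro Inf_lower) auto

lemma orlicz_bounded_sufficient:
  fixes b :: "real^'n \<Rightarrow> real"
  assumes \<beta>: "0 < \<beta>" and \<alpha>: "0 \<le> \<alpha>"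
    and \<Phi>: "young_function \<Phi>" and \<Psi>: "young_function \<Psi>" and Y: "\<Phi> \<in> young_class_Y"
    and nabla: "nabla2 \<Phi>"
    and C: "0 < C" "\<And>t. 0 < t \<Longrightarrow> t powr (- ((\<alpha> + \<beta>) / real CARD('n))) * young_inverse \<Phi> t \<le> C * young_inverse \<Psi> t"
    and b: "b \<in> lipschitz_space \<beta>"
  shows "orlicz_bounded \<Phi> \<Psi> (frac_max_commutator b \<alpha>)"
proof -
  let ?n = "real CARD('n)" and ?v = "unit_ball_vol (real CARD('n))"
  obtain b' L0 where ae: "AE y in lebesgue. b y = b' y"
    and lip0: "\<And>x y. \<bar>b' x - b' y\<bar> \<le> L0 * norm (x - y) powr \<beta>"
    using b unfolding lipschitz_space_def by auto
  \<comment> \<open>Enlarging the constant to a positive one keeps the final \<open>D\<close>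
    positive, so that it can be divided by.\<close>
  define L where "L = \<bar>L0\<bar> + 1"
  have L: "0 < L" unfolding L_def by simp
  have lip: "\<bar>b' x - b' y\<bar> \<le> L * norm (x - y) powr \<beta>" for x y
    using order_trans[OF lip0 mult_right_mono[of L0 L]] unfolding L_def by simp
  obtain K :: real where K: "1 \<le> K" and
    max: "\<And>F :: real^'n \<Rightarrow> real. F \<in> borel_measurable lebesgue \<Longrightarrow> (\<And>x. 0 \<le> F x) \<Longrightarrow>
       (\<integral>\<^sup>+ x. \<Phi> (F x) \<partial>lebesgue) \<le> 1 \<Longrightarrow>
       (\<integral>\<^sup>+ x. young_ext \<Phi> (maximal_function (\<lambda>x. ennreal (F x / K)) x) \<partial>lebesgue) \<le> 1"
    using maximal_function_orlicz[OF \<Phi> nabla] by blast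
  define \<kappa> where "\<kappa> = 2 powr \<beta> * ?v powr (- (\<beta> / ?n))"
  have v: "?v \<noteq> 0" using unit_ball_vol_pos[of ?n] by linarith
  have \<kappa>: "0 < \<kappa>" unfolding \<kappa>_def by (intro mult_pos_pos) (use v in auto)
  \<comment> \<open>The factors come from the Hoelder bound (\<open>L * \<kappa>\<close>), the
    maximal function (\<open>K\<close>) and Hedberg's estimate (\<open>4 * C\<close>).\<close>
  define D where "D = L * \<kappa> * K * (4 * C)"
  have D: "0 < D" unfolding D_def using L \<kappa> K C by simp
  have main: "orlicz_norm \<Psi> (frac_max_commutator b \<alpha> f) \<le> ennreal D * ennreal l"
    if f: "f \<in> borel_measurable lebesgue" and l: "0 < l"
      and le1: "(\<integral>\<^sup>+ x. young_ext \<Phi> (ennreal \<bar>f x\<bar> / ennreal l) \<partial>lebesgue) \<le> 1" for f l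
  proof -
    note [measurable] = f
    define F where "F x = \<bar>f x\<bar> / l" for x
    \<comment> \<open>\<open>F\<close> has modular at most 1; after division by \<open>K\<close> the
      maximal function has it too.\<close>
    define G where "G x = F x / K" for x
    have F0: "0 \<le> F x" and G0: "0 \<le> G x" for x unfolding F_def G_def using l K by auto
    have [measurable]: "F \<in> borel_measurable lebesgue" "G \<in> borel_measurable lebesgue"
      unfolding F_def G_def by measurable
    have intF: "(\<integral>\<^sup>+ x. \<Phi> (F x) \<partial>lebesgue) \<le> 1"
      using le1 l unfolding F_def by (simp add: divide_ennreal young_ext_ennreal)
    have "(\<integral>\<^sup>+ x. \<Phi> (G x) \<partial>lebesgue) \<le> (\<integral>\<^sup>+ x. \<Phi> (F x) \<partial>lebesgue)"
      using F0 K unfolding G_def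
      by (intro nn_integral_mono young_mono[OF \<Phi>]) (auto simp: divide_le_eq mult_left_mono[of 1 K, simplified])
    with intF have intG: "(\<integral>\<^sup>+ x. \<Phi> (G x) \<partial>lebesgue) \<le> 1" by simp
    let ?M = "maximal_function (\<lambda>x. ennreal (G x))"
    \<comment> \<open>This is only claimed where \<open>b\<close> equals its Lipschitz
      representative, which is almost everywhere. Where \<open>?M x\<close> is infinite, so is the
      right-hand side.\<close>
    have "young_ext \<Psi> (frac_max_commutator b \<alpha> f x / ennreal (D * l)) \<le> young_ext \<Phi> (?M x)"
      if x: "b x = b' x" for x
    proof (cases "?M x")
      case (real m)
      have fin: "\<Phi> m < \<infinity>" using Y real young_zero[OF \<Phi>] unfolding young_class_Y_def
        by (cases "m = 0") auto
      let ?w = "young_inverse \<Psi> (enn2real (\<Phi> m))"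
      have w: "0 \<le> ?w" by (rule young_inverse_nonneg[OF \<Psi>])
      have "frac_max_commutator b \<alpha> f x \<le> ennreal (D * l) * ennreal ?w"
        unfolding frac_max_commutator_def
      proof (rule SUP_least)
        fix B assume "B \<in> {ball c r |c r. 0 < r \<and> x \<in> ball c r}"
        then obtain c r where B: "B = ball c r" and r: "0 < r" "x \<in> ball c r" by auto
        let ?V = "measure lebesgue B"
        have "(\<integral>\<^sup>+ y\<in>B. ennreal \<bar>f y\<bar> \<partial>lebesgue) = (\<integral>\<^sup>+ y. ennreal (l * K) * (ennreal (G y) * indicator B y) \<partial>lebesgue)"
        proof (intro nn_integral_cong)
          fix y
          have "\<bar>f y\<bar> = l * K * G y" unfolding G_def F_def using l K by simp
          then show "ennreal \<bar>f y\<bar> * indicator B y = ennreal (l * K) * (ennreal (G y) * indicator B y)"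
            using l K G0 by (simp add: ennreal_mult mult.assoc)
        qed
        also have "\<dots> = ennreal (l * K) * (\<integral>\<^sup>+ y\<in>B. ennreal (G y) \<partial>lebesgue)"
          unfolding B by (rule nn_integral_cmult) measurable
        finally have fG: "(\<integral>\<^sup>+ y\<in>B. ennreal \<bar>f y\<bar> \<partial>lebesgue) = ennreal (l * K) * (\<integral>\<^sup>+ y\<in>B. ennreal (G y) \<partial>lebesgue)" .
        have "ennreal (?V powr (-1 + \<alpha> / ?n)) * (\<integral>\<^sup>+ y\<in>B. ennreal (\<bar>b x - b y\<bar> * \<bar>f y\<bar>) \<partial>lebesgue)
          \<le> ennreal (L * \<kappa>) * (ennreal (?V powr ((\<alpha> + \<beta>) / ?n - 1)) * (\<integral>\<^sup>+ y\<in>B. ennreal \<bar>f y\<bar> \<partial>lebesgue))"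
          unfolding \<kappa>_def B using L by (intro commutator_average_le[OF ae x lip _ \<beta> f r]) simp
        also have "\<dots> = ennreal (L * \<kappa>) * ennreal (l * K) *
            (ennreal (?V powr ((\<alpha> + \<beta>) / ?n - 1)) * (\<integral>\<^sup>+ y\<in>B. ennreal (G y) \<partial>lebesgue))"
          unfolding fG by (simp only: mult_ac)
        also have "\<dots> \<le> ennreal (L * \<kappa>) * ennreal (l * K) * ennreal (4 * C * ?w)"
          unfolding B using Y \<alpha> \<beta> real unfolding young_class_Y_def
          by (intro mult_left_mono hedberg_orlicz[OF \<Phi> \<Psi> _ C _ _ G0 intG r]) auto
        also have "\<dots> = ennreal (D * l) * ennreal ?w"
          unfolding D_def using L \<kappa> l K C w by (simp add: ennreal_mult[symmetric] mult_ac)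
        finally show "ennreal (?V powr (-1 + \<alpha> / ?n)) * (\<integral>\<^sup>+ y\<in>B. ennreal (\<bar>b x - b y\<bar> * \<bar>f y\<bar>) \<partial>lebesgue)
            \<le> ennreal (D * l) * ennreal ?w" .
      qed
      then have "frac_max_commutator b \<alpha> f x / ennreal (D * l) \<le> ennreal ?w"
        using D l by (intro divide_le_posI_ennreal) (auto simp: mult.commute)
      then have "young_ext \<Psi> (frac_max_commutator b \<alpha> f x / ennreal (D * l)) \<le> young_ext \<Psi> (ennreal ?w)"
        by (rule young_ext_mono[OF \<Psi>])
      also have "\<dots> = \<Psi> ?w" using w by (rule young_ext_ennreal)
      also have "\<dots> \<le> ennreal (enn2real (\<Phi> m))" by (rule young_at_inverse[OF \<Psi>])
      also have "\<dots> = young_ext \<Phi> (?M x)" using fin real by (simp add: young_ext_ennreal)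
      finally show ?thesis .
    qed (simp add: young_ext_def)
    then have "AE x in lebesgue. young_ext \<Psi> (frac_max_commutator b \<alpha> f x / ennreal (D * l)) \<le> young_ext \<Phi> (?M x)"
      using ae by (auto elim: eventually_mono)
    then have "(\<integral>\<^sup>+ x. young_ext \<Psi> (frac_max_commutator b \<alpha> f x / ennreal (D * l)) \<partial>lebesgue)
        \<le> (\<integral>\<^sup>+ x. young_ext \<Phi> (?M x) \<partial>lebesgue)"
      by (rule nn_integral_mono_AE)
    also have "\<dots> \<le> 1" unfolding G_def by (rule max[OF _ F0 intF]) measurable
    finally have "orlicz_norm \<Psi> (frac_max_commutator b \<alpha> f) \<le> ennreal (D * l)"
      using D l by (intro orlicz_norm_le) auto
    then show ?thesis using D l by (simp add: ennreal_mult)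
  qed
  show ?thesis
    unfolding orlicz_bounded_def
  proof (intro exI[of _ D] conjI ballI)
    fix f :: "real^'n \<Rightarrow> real" assume "f \<in> orlicz_space \<Phi>"
    then have f: "f \<in> borel_measurable lebesgue"
      unfolding orlicz_space_def by (auto intro: locally_integrable_measurable)
    \<comment> \<open>With \<open>D\<close> moved to the left, the right-hand side is a bare
      infimum; it need not be attained and may be taken over the empty set.\<close>
    have "orlicz_norm \<Psi> (frac_max_commutator b \<alpha> f) / ennreal D \<le> orlicz_norm \<Phi> (\<lambda>x. ennreal \<bar>f x\<bar>)"
      unfolding orlicz_norm_def[of \<Phi>]
    proof (rule Inf_greatest)
      fix a assume "a \<in> {ennreal l | l. 0 < l \<and> (\<integral>\<^sup>+ x. young_ext \<Phi> (ennreal \<bar>f x\<bar> / ennreal l) \<partial>lebesgue) \<le> 1}"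
      then obtain l where "a = ennreal l" "0 < l" "(\<integral>\<^sup>+ x. young_ext \<Phi> (ennreal \<bar>f x\<bar> / ennreal l) \<partial>lebesgue) \<le> 1"
        by auto
      then show "orlicz_norm \<Psi> (frac_max_commutator b \<alpha> f) / ennreal D \<le> a"
        using main[OF f, of l] D by (intro divide_le_posI_ennreal) auto
    qed
    then have "ennreal D * (orlicz_norm \<Psi> (frac_max_commutator b \<alpha> f) / ennreal D) \<le> ennreal D * orlicz_norm \<Phi> (\<lambda>x. ennreal \<bar>f x\<bar>)"
      by (rule mult_left_mono) simp
    moreover have "ennreal D * (q / ennreal D) = q" for q
      using D ennreal_mult_divide_eq[of "ennreal D" q]
      by (simp add: ennreal_times_divide mult.commute[of "ennreal D"])
    ultimately show "orlicz_norm \<Psi> (frac_max_commutator b \<alpha> f) \<le> ennreal D * orlicz_norm \<Phi> (\<lambda>x. ennreal \<bar>f x\<bar>)"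
      by simp
  qed (use D in simp)
qed

section \<open>Necessity\<close>

text \<open>Needed for the measurability of an integral in its parameter, as in
  \<open>oscillation_measurable\<close>.\<close>

lemma sigma_finite_lebesgue: "sigma_finite_measure (lebesgue :: 'a::euclidean_space measure)"
proof
  show "\<exists>A. countable A \<and> A \<subseteq> sets (lebesgue :: 'a measure) \<and> \<Union> A = space lebesgue \<and>
      (\<forall>a\<in>A. emeasure lebesgue a \<noteq> \<infinity>)"
  proof (intro exI[of _ "range (\<lambda>k. ball (0::'a) (real k))"] conjI)
    show "\<Union> (range (\<lambda>k. ball (0::'a) (real k))) = space lebesgue"
      using reals_Archimedean2 by auto
    show "\<forall>a\<in>range (\<lambda>k. ball (0::'a) (real k)). emeasure lebesgue a \<noteq> \<infinity>"
      by (auto simp: emeasure_lebesgue_ball)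
  qed auto
qed

lemma oscillation_measurable:
  fixes b :: "'a::euclidean_space \<Rightarrow> real"
  assumes [measurable]: "b \<in> borel_measurable lebesgue" "S \<in> sets lebesgue"
  shows "(\<lambda>x. \<integral>\<^sup>+ y\<in>S. ennreal \<bar>b x - b y\<bar> \<partial>lebesgue) \<in> borel_measurable lebesgue"
proof -
  interpret sigma_finite_measure "lebesgue :: 'a measure" by (rule sigma_finite_lebesgue)
  show ?thesis by measurable
qed

text \<open>The scale \<open>l = 1 / young_inverse \<Phi> (1 / V)\<close> is admissible: the modular
  becomes \<open>V\<close> times the value of \<open>\<Phi>\<close> at its own inverse of
  \<open>1 / V\<close>, so \<open>young_at_inverse\<close> bounds it by 1.\<close>

lemma orlicz_norm_indicator_le:
  fixes S :: "(real^'n) set"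
  assumes \<Phi>: "young_function \<Phi>" and S: "S \<in> sets lebesgue" "emeasure lebesgue S = ennreal V" and V: "0 < V"
  shows "orlicz_norm \<Phi> (\<lambda>x. ennreal \<bar>indicator S x\<bar>) \<le> ennreal (1 / young_inverse \<Phi> (1 / V))"
proof -
  let ?p = "young_inverse \<Phi> (1 / V)"
  have p: "0 < ?p" using V by (intro young_inverse_pos[OF \<Phi>]) simp
  have "(\<integral>\<^sup>+ x. young_ext \<Phi> (ennreal \<bar>indicator S x\<bar> / ennreal (1 / ?p)) \<partial>lebesgue)
      = (\<integral>\<^sup>+ x. \<Phi> ?p * indicator S x \<partial>lebesgue)"
  proof (rule nn_integral_cong)
    fix x
    have "1 / ennreal (1 / ?p) = ennreal ?p" using p divide_ennreal[of 1 "1 / ?p"] by simp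
    then show "young_ext \<Phi> (ennreal \<bar>indicator S x\<bar> / ennreal (1 / ?p)) = \<Phi> ?p * indicator S x"
      using p young_zero[OF \<Phi>] by (cases "x \<in> S") (auto simp: young_ext_ennreal young_ext_def)
  qed
  also have "\<dots> = \<Phi> ?p * ennreal V" using S by (simp add: nn_integral_cmult_indicator)
  also have "\<dots> \<le> ennreal (1 / V) * ennreal V"
    by (intro mult_right_mono young_at_inverse[OF \<Phi>]) simp
  also have "\<dots> = 1" using V by (simp add: ennreal_mult[symmetric])
  finally show ?thesis using p by (intro orlicz_norm_le) auto
qed

lemma indicator_in_orlicz_space:
  fixes S :: "(real^'n) set"
  assumes Y: "\<Phi> \<in> young_class_Y" and S: "S \<in> sets lebesgue" "emeasure lebesgue S < \<infinity>"
  shows "indicator S \<in> orlicz_space \<Phi>"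
proof -
  have \<Phi>: "young_function \<Phi>" and fin: "\<Phi> 1 < \<infinity>" using Y unfolding young_class_Y_def by auto
  have "locally_integrable (indicator S :: real^'n \<Rightarrow> real)"
    unfolding locally_integrable_def set_integrable_def
  proof (intro allI impI)
    fix T :: "(real^'n) set" assume "compact T"
    then have T: "T \<in> sets lebesgue" by (simp add: borel_compact)
    have "emeasure lebesgue (T \<inter> S) \<le> emeasure lebesgue S"
      using S by (intro emeasure_mono) auto
    then have "integrable lebesgue (indicator (T \<inter> S) :: real^'n \<Rightarrow> real)"
      using S T by (intro integrable_real_indicator) (auto intro: le_less_trans)
    moreover have "(\<lambda>x. indicator T x *\<^sub>R indicator S x :: real) = indicator (T \<inter> S)"
      by (auto simp: indicator_def)
    ultimately show "integrable lebesgue (\<lambda>x. indicator T x *\<^sub>R indicator S x :: real)" by simp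
  qed
  moreover have "(\<integral>\<^sup>+ x. \<Phi> (1 * \<bar>indicator S x\<bar>) \<partial>lebesgue) < \<infinity>"
  proof -
    have "(\<integral>\<^sup>+ x. \<Phi> (1 * \<bar>indicator S x\<bar>) \<partial>lebesgue) = (\<integral>\<^sup>+ x. \<Phi> 1 * indicator S x \<partial>lebesgue)"
      using young_zero[OF \<Phi>] by (intro nn_integral_cong) (auto simp: indicator_def)
    also have "\<dots> = \<Phi> 1 * emeasure lebesgue S" using S by (simp add: nn_integral_cmult_indicator)
    also have "\<dots> < \<infinity>" using fin S by (simp add: ennreal_mult_less_top)
    finally show ?thesis .
  qed
  ultimately show ?thesis unfolding orlicz_space_def by (auto intro!: exI[of _ 1])
qed

text \<open>For \<open>x\<close> in a ball, that ball competes in the supremum, so the commutator of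
  its indicator dominates the inner oscillation integral at \<open>x\<close>. Boundedness then
  controls a \<open>\<Psi>\<close> modular over the ball, and
  \<open>nn_integral_le_above_young_inverse\<close> turns this into an integral bound.\<close>

lemma oscillation_bound_necessary:
  fixes b :: "real^'n \<Rightarrow> real"
  assumes \<Psi>: "young_function \<Psi>" and Y: "\<Phi> \<in> young_class_Y"
    and b [measurable]: "b \<in> borel_measurable lebesgue"
    and C: "0 < C" "\<And>t. 0 < t \<Longrightarrow> young_inverse \<Psi> t \<le> C * young_inverse \<Phi> t * t powr (- ((\<alpha> + \<beta>) / real CARD('n)))"
    and bd: "orlicz_bounded \<Phi> \<Psi> (frac_max_commutator b \<alpha>)"
  obtains K where "0 \<le> K"
    "\<And>c r. 0 < r \<Longrightarrow> (\<integral>\<^sup>+ x\<in>ball c r. (\<integral>\<^sup>+ y\<in>ball c r. ennreal \<bar>b x - b y\<bar> \<partial>lebesgue) \<partial>lebesgue)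
        \<le> ennreal (K * r powr \<beta> * (measure lebesgue (ball c r))\<^sup>2)"
proof -
  let ?n = "real CARD('n)" and ?v = "unit_ball_vol (real CARD('n))"
  have \<Phi>: "young_function \<Phi>" using Y unfolding young_class_Y_def by auto
  obtain C0 where C0: "0 \<le> C0" "\<And>f. f \<in> orlicz_space \<Phi> \<Longrightarrow>
      orlicz_norm \<Psi> (frac_max_commutator b \<alpha> f) \<le> ennreal C0 * orlicz_norm \<Phi> (\<lambda>x. ennreal \<bar>f x\<bar>)"
    using bd unfolding orlicz_bounded_def by auto
  \<comment> \<open>One factor 2 is that of the integral bound, the other comes from
    \<open>u\<close>; \<open>C0 + 1\<close> is the operator bound with slack, and the power of the
    unit ball volume converts volume into radius.\<close>
  define K where "K = 4 * C * (C0 + 1) * ?v powr (\<beta> / ?n)"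
  show thesis
  proof (rule that[of K])
    show "0 \<le> K" unfolding K_def using C C0 by simp
    fix c :: "real^'n" and r :: real assume r: "0 < r"
    let ?B = "ball c r"
    define V where "V = measure lebesgue ?B"
    have V: "0 < V" unfolding V_def using r by (intro measure_lebesgue_ball_pos)
    have eV: "emeasure lebesgue ?B = ennreal V"
      unfolding V_def using r by (intro emeasure_lebesgue_ball_eq_measure) simp
    define p where "p = young_inverse \<Phi> (1 / V)"
    have p: "0 < p" unfolding p_def using V by (intro young_inverse_pos[OF \<Phi>]) simp
    let ?T = "frac_max_commutator b \<alpha> (indicator ?B)"
    have "orlicz_norm \<Psi> ?T \<le> ennreal C0 * orlicz_norm \<Phi> (\<lambda>x. ennreal \<bar>indicator ?B x\<bar>)"
      using Y eV by (intro C0 indicator_in_orlicz_space) auto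
    also have "\<dots> \<le> ennreal C0 * ennreal (1 / p)"
      unfolding p_def using V eV by (intro mult_left_mono orlicz_norm_indicator_le[OF \<Phi>]) auto
    \<comment> \<open>The slack makes the bound strict, so that the infimum yields an actual
      \<open>l\<close>.\<close>
    also have "\<dots> < ennreal ((C0 + 1) / p)"
      using C0 p by (simp add: ennreal_mult[symmetric] ennreal_less_iff field_simps)
    finally obtain l where l: "0 < l" "ennreal l < ennreal ((C0 + 1) / p)"
      "(\<integral>\<^sup>+ x. young_ext \<Psi> (?T x / ennreal l) \<partial>lebesgue) \<le> 1"
      unfolding orlicz_norm_def Inf_less_iff by auto
    have l_le: "l \<le> (C0 + 1) / p" using l by (simp add: ennreal_less_iff)
    let ?h = "\<lambda>x. \<integral>\<^sup>+ y\<in>?B. ennreal \<bar>b x - b y\<bar> \<partial>lebesgue"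
    have [measurable]: "?h \<in> borel_measurable lebesgue" by (rule oscillation_measurable) auto
    define a where "a = V powr (-1 + \<alpha> / ?n) / l"
    have a: "0 < a" unfolding a_def using V l by simp
    have T: "ennreal a * ?h x \<le> ?T x / ennreal l" if "x \<in> ?B" for x
    proof -
      have "ennreal (V powr (-1 + \<alpha> / ?n)) * (\<integral>\<^sup>+ y\<in>?B. ennreal (\<bar>b x - b y\<bar> * \<bar>indicator ?B y\<bar>) \<partial>lebesgue) \<le> ?T x"
        unfolding frac_max_commutator_def V_def using that r by (intro SUP_upper) auto
      moreover have "(\<integral>\<^sup>+ y\<in>?B. ennreal (\<bar>b x - b y\<bar> * \<bar>indicator ?B y\<bar>) \<partial>lebesgue) = ?h x"
        by (intro nn_integral_cong) (auto simp: indicator_def)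
      ultimately have le: "ennreal (V powr (-1 + \<alpha> / ?n)) * ?h x \<le> ?T x" by simp
      have "ennreal a = ennreal (V powr (-1 + \<alpha> / ?n)) / ennreal l"
        unfolding a_def using l by (simp add: divide_ennreal)
      then have "ennreal a * ?h x = ennreal (V powr (-1 + \<alpha> / ?n)) * ?h x / ennreal l"
        by (simp only: ennreal_divide_times ennreal_times_divide)
      then show ?thesis using divide_right_mono_ennreal[OF le, of "ennreal l"] by simp
    qed
    have "(\<integral>\<^sup>+ x\<in>?B. young_ext \<Psi> (ennreal a * ?h x) \<partial>lebesgue) \<le> (\<integral>\<^sup>+ x. young_ext \<Psi> (?T x / ennreal l) \<partial>lebesgue)"
      using young_ext_mono[OF \<Psi> T] by (intro nn_integral_mono) (auto simp: indicator_def)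
    with l(3) have le1: "(\<integral>\<^sup>+ x\<in>?B. young_ext \<Psi> (ennreal a * ?h x) \<partial>lebesgue) \<le> 1" by simp
    define u where "u = 2 * (C * p * V powr ((\<alpha> + \<beta>) / ?n))"
    have "young_inverse \<Psi> (1 / V) \<le> C * p * (1 / V) powr (- ((\<alpha> + \<beta>) / ?n))"
      unfolding p_def using V by (intro C) simp
    also have "\<dots> = C * p * V powr ((\<alpha> + \<beta>) / ?n)" using V by (simp add: powr_minus powr_divide)
    also have "\<dots> < u" unfolding u_def using C p V by simp
    finally have u: "young_inverse \<Psi> (1 / V) < u" .
    have "(\<integral>\<^sup>+ x\<in>?B. ennreal a * ?h x \<partial>lebesgue) \<le> ennreal (2 * u * V)"
      by (rule nn_integral_le_above_young_inverse[OF \<Psi> _ _ eV V le1 u]) auto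
    also have "(\<integral>\<^sup>+ x\<in>?B. ennreal a * ?h x \<partial>lebesgue) = ennreal a * (\<integral>\<^sup>+ x\<in>?B. ?h x \<partial>lebesgue)"
      by (subst nn_integral_cmult[symmetric]) (auto simp: mult.assoc)
    finally have "ennreal (1 / a) * (ennreal a * (\<integral>\<^sup>+ x\<in>?B. ?h x \<partial>lebesgue)) \<le> ennreal (1 / a) * ennreal (2 * u * V)"
      by (rule mult_left_mono) simp
    moreover have "ennreal (1 / a) * (ennreal a * (\<integral>\<^sup>+ x\<in>?B. ?h x \<partial>lebesgue)) = (\<integral>\<^sup>+ x\<in>?B. ?h x \<partial>lebesgue)"
      using a by (simp add: mult.assoc[symmetric] ennreal_mult[symmetric])
    moreover have "ennreal (1 / a) * ennreal (2 * u * V) \<le> ennreal (K * r powr \<beta> * V\<^sup>2)"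
    proof -
      have V\<beta>: "V powr (\<beta> / ?n) = ?v powr (\<beta> / ?n) * r powr \<beta>"
        unfolding V_def using r by (simp add: measure_lebesgue_ball powr_mult powr_powr powr_realpow[symmetric])
      \<comment> \<open>The factor \<open>p\<close> in \<open>u\<close> will cancel against
        \<open>l \<le> (C0 + 1) / p\<close>, and the exponents of \<open>V\<close> add up to 2 +
        \<beta>/n.\<close>
      have "1 / a * (2 * u * V) = l * (4 * C * p * (V powr (1 - \<alpha> / ?n) * V powr ((\<alpha> + \<beta>) / ?n) * V))"
      proof -
        have "V powr (1 - \<alpha> / ?n) = V powr (- (-1 + \<alpha> / ?n))" by simp
        then have "1 / a = l * V powr (1 - \<alpha> / ?n)"
          unfolding a_def powr_minus by (simp add: divide_inverse)
        then show ?thesis unfolding u_def by simp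
      qed
      also have "V powr (1 - \<alpha> / ?n) * V powr ((\<alpha> + \<beta>) / ?n) = V * V powr (\<beta> / ?n)"
      proof -
        have "1 - \<alpha> / ?n + (\<alpha> + \<beta>) / ?n = 1 + \<beta> / ?n" by (simp add: add_divide_distrib)
        then show ?thesis using V by (simp only: powr_add[symmetric] powr_mult_base less_imp_le)
      qed
      also have "l * (4 * C * p * (V * V powr (\<beta> / ?n) * V)) \<le> (C0 + 1) / p * (4 * C * p * (V * V powr (\<beta> / ?n) * V))"
        using l_le C p V by (intro mult_right_mono) auto
      also have "\<dots> = K * r powr \<beta> * V\<^sup>2"
        unfolding K_def V\<beta> using p by (simp add: power2_eq_square)
      finally have "1 / a * (2 * u * V) \<le> K * r powr \<beta> * V\<^sup>2" .
      moreover have "0 \<le> u" unfolding u_def using C p by simp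
      ultimately show ?thesis using a V by (simp add: ennreal_mult[symmetric] ennreal_leI)
    qed
    ultimately show "(\<integral>\<^sup>+ x\<in>?B. ?h x \<partial>lebesgue) \<le> ennreal (K * r powr \<beta> * (measure lebesgue ?B)\<^sup>2)"
      unfolding V_def by simp
  qed
qed

section \<open>Campanato's argument\<close>

lemma average_deviation_le:
  fixes b :: "'a \<Rightarrow> real"
  assumes S: "S \<in> sets M" "emeasure M S = ennreal V" "0 < V" and b: "set_integrable M S b"
  shows "ennreal (V * \<bar>(LINT x:S|M. b x) / V - c\<bar>) \<le> (\<integral>\<^sup>+ x\<in>S. ennreal \<bar>b x - c\<bar> \<partial>M)"
proof -
  have mS: "measure M S = V" using S by (simp add: measure_def)
  have c: "set_integrable M S (\<lambda>x. c)"
    unfolding set_integrable_def using S by (intro integrable_scaleR_left integrable_real_indicator) auto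
  have "(LINT x:S|M. b x - c) = (LINT x:S|M. b x) - (LINT x:S|M. c)"
    using b c by (rule set_integral_diff(2))
  also have "(LINT x:S|M. c) = c * V"
    using S mS unfolding set_lebesgue_integral_def by (simp add: mult.commute)
  finally have "\<bar>(LINT x:S|M. b x - c)\<bar> = V * \<bar>(LINT x:S|M. b x) / V - c\<bar>"
    using S(3) by (subst (2) abs_of_pos[of V, symmetric]) (auto simp: abs_mult[symmetric] field_simps)
  then have "ennreal (V * \<bar>(LINT x:S|M. b x) / V - c\<bar>) = ennreal (norm (LINT x|M. indicator S x *\<^sub>R (b x - c)))"
    unfolding set_lebesgue_integral_def by simp
  also have "\<dots> \<le> (\<integral>\<^sup>+ x. norm (indicator S x *\<^sub>R (b x - c)) \<partial>M)"
    using set_integral_diff(1)[OF b c] unfolding set_integrable_def by (rule integral_norm_bound_ennreal)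
  also have "\<dots> = (\<integral>\<^sup>+ x\<in>S. ennreal \<bar>b x - c\<bar> \<partial>M)"
    by (intro nn_integral_cong) (auto simp: indicator_def)
  finally show ?thesis .
qed

text \<open>Separates the real-variable argument from Orlicz spaces: \<open>oscillation\<close> says
  that the mean oscillation over balls is O(r^\<beta>), multiplied out by the squared volume to
  avoid division.\<close>

locale campanato =
  fixes b :: "'a::euclidean_space \<Rightarrow> real" and \<beta> K :: real
  assumes \<beta>: "0 < \<beta>" and K: "0 \<le> K"
    and measurable_b [measurable]: "b \<in> borel_measurable lebesgue"
    and integrable_b: "\<And>c r. set_integrable lebesgue (ball c r) b"
    and oscillation: "\<And>c r. 0 < r \<Longrightarrow>
      (\<integral>\<^sup>+ x\<in>ball c r. (\<integral>\<^sup>+ y\<in>ball c r. ennreal \<bar>b x - b y\<bar> \<partial>lebesgue) \<partial>lebesgue)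
        \<le> ennreal (K * r powr \<beta> * (measure lebesgue (ball c r))\<^sup>2)"
begin

definition avg :: "'a \<Rightarrow> real \<Rightarrow> real" where
  "avg x r = (LINT y:ball x r|lebesgue. b y) / measure lebesgue (ball x r)"

lemma avg_deviation_le:
  assumes "0 < r"
  shows "ennreal (measure lebesgue (ball x r) * \<bar>avg x r - c\<bar>)
      \<le> (\<integral>\<^sup>+ y\<in>ball x r. ennreal \<bar>b y - c\<bar> \<partial>lebesgue)"
  unfolding avg_def using assms
  by (intro average_deviation_le integrable_b emeasure_lebesgue_ball_eq_measure measure_lebesgue_ball_pos) auto

text \<open>Replaces an average by the integral defining it. The set \<open>S\<close> is independent
  of the averaging ball, so that two different balls can be compared.\<close>

lemma scaled_deviation_le:
  assumes [measurable]: "S \<in> sets lebesgue" and s: "0 < s"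
  shows "ennreal (measure lebesgue (ball y s)) * (\<integral>\<^sup>+ x\<in>S. ennreal \<bar>b x - avg y s\<bar> \<partial>lebesgue)
     \<le> (\<integral>\<^sup>+ x\<in>S. (\<integral>\<^sup>+ z\<in>ball y s. ennreal \<bar>b x - b z\<bar> \<partial>lebesgue) \<partial>lebesgue)"
proof -
  have "ennreal (measure lebesgue (ball y s)) * (\<integral>\<^sup>+ x\<in>S. ennreal \<bar>b x - avg y s\<bar> \<partial>lebesgue)
     = (\<integral>\<^sup>+ x. ennreal (measure lebesgue (ball y s)) * (ennreal \<bar>b x - avg y s\<bar> * indicator S x) \<partial>lebesgue)"
    by (rule nn_integral_cmult[symmetric]) measurable
  also have "\<dots> \<le> (\<integral>\<^sup>+ x\<in>S. (\<integral>\<^sup>+ z\<in>ball y s. ennreal \<bar>b x - b z\<bar> \<partial>lebesgue) \<partial>lebesgue)"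
  proof (rule nn_integral_mono)
    fix x
    have "ennreal (measure lebesgue (ball y s)) * ennreal \<bar>b x - avg y s\<bar>
        \<le> (\<integral>\<^sup>+ z\<in>ball y s. ennreal \<bar>b x - b z\<bar> \<partial>lebesgue)"
      using avg_deviation_le[OF s, of y "b x"]
      by (simp add: ennreal_mult abs_minus_commute)
    then show "ennreal (measure lebesgue (ball y s)) * (ennreal \<bar>b x - avg y s\<bar> * indicator S x)
        \<le> (\<integral>\<^sup>+ z\<in>ball y s. ennreal \<bar>b x - b z\<bar> \<partial>lebesgue) * indicator S x"
      by (simp add: indicator_def)
  qed
  finally show ?thesis .
qed

text \<open>Each of the two inner balls in \<open>avg_diff_le\<close> has at least
  \<open>1 / 4 ^ DIM('a)\<close> of the volume of the outer one, which gives
  \<open>16 ^ DIM('a)\<close> for the product.\<close>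

definition osc_const :: real where "osc_const = 16 ^ DIM('a) * K"

lemma osc_const_nonneg: "0 \<le> osc_const"
  unfolding osc_const_def using K by simp

lemma avg_diff_le:
  assumes sub: "ball x s \<subseteq> ball z r" "ball y t \<subseteq> ball z r" and r: "0 < r" "r \<le> 4 * s" "r \<le> 4 * t"
  shows "\<bar>avg x s - avg y t\<bar> \<le> osc_const * r powr \<beta>"
proof -
  let ?\<mu> = "measure (lebesgue :: 'a measure)" and ?N = "DIM('a)"
  have s: "0 < s" and t: "0 < t" using r by auto
  have pos: "0 < ?\<mu> (ball x s)" "0 < ?\<mu> (ball y t)" using s t by (auto intro: measure_lebesgue_ball_pos)
  have "ennreal (?\<mu> (ball y t) * (?\<mu> (ball x s) * \<bar>avg x s - avg y t\<bar>))
     = ennreal (?\<mu> (ball y t)) * ennreal (?\<mu> (ball x s) * \<bar>avg x s - avg y t\<bar>)"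
    by (intro ennreal_mult) auto
  also have "\<dots> \<le> ennreal (?\<mu> (ball y t)) * (\<integral>\<^sup>+ w\<in>ball x s. ennreal \<bar>b w - avg y t\<bar> \<partial>lebesgue)"
    by (intro mult_left_mono avg_deviation_le s) simp
  also have "\<dots> \<le> (\<integral>\<^sup>+ w\<in>ball x s. (\<integral>\<^sup>+ v\<in>ball y t. ennreal \<bar>b w - b v\<bar> \<partial>lebesgue) \<partial>lebesgue)"
    by (rule scaled_deviation_le[OF _ t]) simp
  also have "\<dots> \<le> (\<integral>\<^sup>+ w\<in>ball z r. (\<integral>\<^sup>+ v\<in>ball z r. ennreal \<bar>b w - b v\<bar> \<partial>lebesgue) \<partial>lebesgue)"
    using sub by (intro nn_integral_mono mult_mono) (auto simp: indicator_def)
  also have "\<dots> \<le> ennreal (K * r powr \<beta> * (?\<mu> (ball z r))\<^sup>2)" by (rule oscillation[OF r(1)])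
  finally have le: "?\<mu> (ball y t) * (?\<mu> (ball x s) * \<bar>avg x s - avg y t\<bar>) \<le> K * r powr \<beta> * (?\<mu> (ball z r))\<^sup>2"
    using K by (subst (asm) ennreal_le_iff) auto
  have big: "?\<mu> (ball z r) \<le> 4 ^ ?N * ?\<mu> (ball w q)" if "r \<le> 4 * q" for w q
  proof -
    have "r ^ ?N \<le> (4 * q) ^ ?N" using that r by (intro power_mono) auto
    then show ?thesis using that r
      by (simp add: measure_lebesgue_ball power_mult_distrib)
  qed
  have "(?\<mu> (ball z r))\<^sup>2 \<le> (4 ^ ?N * ?\<mu> (ball x s)) * (4 ^ ?N * ?\<mu> (ball y t))"
    unfolding power2_eq_square using big[OF r(2)] big[OF r(3)] by (intro mult_mono) auto
  also have "\<dots> = 16 ^ ?N * (?\<mu> (ball y t) * ?\<mu> (ball x s))"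
    by (simp add: power_mult_distrib[symmetric])
  finally have "K * r powr \<beta> * (?\<mu> (ball z r))\<^sup>2 \<le> K * r powr \<beta> * (16 ^ ?N * (?\<mu> (ball y t) * ?\<mu> (ball x s)))"
    using K by (intro mult_left_mono) auto
  with le have "(?\<mu> (ball y t) * ?\<mu> (ball x s)) * \<bar>avg x s - avg y t\<bar>
      \<le> (?\<mu> (ball y t) * ?\<mu> (ball x s)) * (osc_const * r powr \<beta>)"
    unfolding osc_const_def by (simp add: mult_ac)
  then show ?thesis using pos by (subst (asm) mult_le_cancel_left_pos) auto
qed

text \<open>The sum of the geometric series of bounds
  \<open>osc_const * (1 / 2) powr (k * \<beta>)\<close> obtained by repeatedly halving the radius;
  equivalently the fixed point used in the induction.\<close>

definition concentric_const :: real where "concentric_const = osc_const / (1 - (1 / 2) powr \<beta>)"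

lemma half_powr_less_one: "(1 / 2) powr \<beta> < (1::real)"
  using powr_less_mono2[of \<beta> "1 / 2" 1] \<beta> by simp

lemma concentric_const_bounds: "0 \<le> concentric_const" "osc_const \<le> concentric_const" "osc_const + concentric_const * (1 / 2) powr \<beta> = concentric_const"
proof -
  let ?h = "(1 / 2 :: real) powr \<beta>"
  have h: "0 < 1 - ?h" "0 \<le> ?h" using half_powr_less_one by auto
  show D: "0 \<le> concentric_const" unfolding concentric_const_def using osc_const_nonneg h by simp
  have "concentric_const * (1 - ?h) = osc_const" by (metis concentric_const_def h(1) less_irrefl nonzero_divide_eq_eq)
  then show eq: "osc_const + concentric_const * ?h = concentric_const" by (simp add: algebra_simps)
  show "osc_const \<le> concentric_const" using eq mult_nonneg_nonneg[OF D h(2)] by linarith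
qed

text \<open>The number \<open>k\<close> only bounds how often \<open>r\<close> has to be halved
  before it is within a factor 2 of \<open>s\<close>. The bound for \<open>r / 2\<close> plus one
  step of size \<open>osc_const * r powr \<beta>\<close> reproduces the same constant.\<close>

lemma avg_concentric_le_aux:
  "0 < s \<Longrightarrow> s \<le> r \<Longrightarrow> r \<le> 2 ^ k * s \<Longrightarrow> \<bar>avg x r - avg x s\<bar> \<le> concentric_const * r powr \<beta>"
proof (induction k arbitrary: r)
  case 0
  then have "r = s" by simp
  then show ?case using concentric_const_bounds by simp
next
  case (Suc k)
  show ?case
  proof (cases "r \<le> 2 * s")
    case True
    have "\<bar>avg x r - avg x s\<bar> \<le> osc_const * r powr \<beta>"
      using Suc.prems True by (intro avg_diff_le[of x r x r x s]) auto
    also have "\<dots> \<le> concentric_const * r powr \<beta>" using concentric_const_bounds by (intro mult_right_mono) auto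
    finally show ?thesis .
  next
    case False
    have "\<bar>avg x r - avg x (r / 2)\<bar> \<le> osc_const * r powr \<beta>"
      using Suc.prems by (intro avg_diff_le[of x r x r x "r / 2"]) auto
    moreover have "\<bar>avg x (r / 2) - avg x s\<bar> \<le> concentric_const * ((1 / 2) powr \<beta> * r powr \<beta>)"
    proof -
      have "(r / 2) powr \<beta> = (1 / 2) powr \<beta> * r powr \<beta>"
        using Suc.prems powr_mult[of "1 / 2" r \<beta>] by simp
      moreover have "\<bar>avg x (r / 2) - avg x s\<bar> \<le> concentric_const * (r / 2) powr \<beta>"
        using Suc.prems False by (intro Suc.IH) auto
      ultimately show ?thesis by simp
    qed
    moreover have "concentric_const * r powr \<beta> = osc_const * r powr \<beta> + concentric_const * ((1 / 2) powr \<beta> * r powr \<beta>)"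
      using concentric_const_bounds(3) by (metis distrib_right mult.assoc)
    ultimately show ?thesis by linarith
  qed
qed

lemma avg_concentric_le:
  assumes "0 < s" "s \<le> r"
  shows "\<bar>avg x r - avg x s\<bar> \<le> concentric_const * r powr \<beta>"
proof -
  obtain k :: nat where "r / s < 2 ^ k" using real_arch_pow[of 2 "r / s"] by auto
  then have "r \<le> 2 ^ k * s" using assms by (simp add: field_simps)
  with assms show ?thesis by (rule avg_concentric_le_aux)
qed

text \<open>Radii \<open>1 / (k + 1)\<close> suffice to define the limit;
  \<open>avg_concentric_le\<close> makes the sequence Cauchy at every \<open>x\<close> and controls
  all other radii.\<close>

definition b_rep :: "'a \<Rightarrow> real" where
  "b_rep x = lim (\<lambda>k. avg x (inverse (real (Suc k))))"

lemma powr_inverse_Suc_tendsto_0: "(\<lambda>k. c * inverse (real (Suc k)) powr \<beta>) \<longlonglongrightarrow> 0"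
  using tendsto_mult[OF tendsto_const[of c] tendsto_zero_powrI[OF LIMSEQ_inverse_real_of_nat tendsto_const[of \<beta>]]] \<beta>
  by simp

lemma avg_tendsto: "(\<lambda>k. avg x (inverse (real (Suc k)))) \<longlonglongrightarrow> b_rep x"
proof -
  let ?X = "\<lambda>k. avg x (inverse (real (Suc k)))"
  have "Cauchy ?X"
  proof (rule CauchyI)
    fix e :: real assume e: "0 < e"
    obtain M where M: "concentric_const * inverse (real (Suc M)) powr \<beta> < e / 2"
      using order_tendstoD(2)[OF powr_inverse_Suc_tendsto_0[of concentric_const], of "e / 2"] e
      by (auto simp: eventually_sequentially)
    have near: "\<bar>?X M - ?X m\<bar> < e / 2" if "M \<le> m" for m
      using avg_concentric_le[of "inverse (real (Suc m))" "inverse (real (Suc M))" x] M that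
      by (simp add: inverse_eq_divide frac_le)
    show "\<exists>M. \<forall>m\<ge>M. \<forall>n\<ge>M. norm (?X m - ?X n) < e"
    proof (intro exI[of _ M] allI impI)
      fix m n :: nat assume "M \<le> m" "M \<le> n"
      then show "norm (?X m - ?X n) < e" using near[of m] near[of n] unfolding real_norm_def by linarith
    qed
  qed
  then show ?thesis unfolding b_rep_def by (simp add: Cauchy_convergent_iff convergent_LIMSEQ_iff)
qed

lemma avg_b_rep_le:
  assumes r: "0 < r"
  shows "\<bar>avg x r - b_rep x\<bar> \<le> concentric_const * r powr \<beta>"
proof (rule tendsto_upperbound)
  show "(\<lambda>k. \<bar>avg x r - avg x (inverse (real (Suc k)))\<bar>) \<longlonglongrightarrow> \<bar>avg x r - b_rep x\<bar>"
    by (intro tendsto_intros avg_tendsto)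
  have "eventually (\<lambda>k. inverse (real (Suc k)) < r) sequentially"
    using order_tendstoD(2)[OF LIMSEQ_inverse_real_of_nat r] .
  then show "eventually (\<lambda>k. \<bar>avg x r - avg x (inverse (real (Suc k)))\<bar> \<le> concentric_const * r powr \<beta>) sequentially"
    by eventually_elim (intro avg_concentric_le, auto)
qed simp

text \<open>At scale \<open>r = norm (x - y)\<close> each of the two points costs
  \<open>concentric_const\<close>, and comparing the two averages inside a ball of radius
  \<open>2 * r\<close> costs \<open>osc_const * 2 powr \<beta>\<close>.\<close>

definition hoelder_const :: real where "hoelder_const = 2 * concentric_const + osc_const * 2 powr \<beta>"

lemma hoelder_const_nonneg: "0 \<le> hoelder_const"
  unfolding hoelder_const_def using concentric_const_bounds osc_const_nonneg by simp

lemma b_rep_hoelder: "\<bar>b_rep x - b_rep y\<bar> \<le> hoelder_const * norm (x - y) powr \<beta>"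
proof (cases "x = y")
  case False
  define r where "r = norm (x - y)"
  have r: "0 < r" unfolding r_def using False by simp
  have "ball y r \<subseteq> ball x (2 * r)"
    unfolding r_def by (intro ball_subset_ball_iff[THEN iffD2]) (auto simp: dist_norm norm_minus_commute)
  then have "\<bar>avg x r - avg y r\<bar> \<le> osc_const * (2 * r) powr \<beta>"
    using r by (intro avg_diff_le[of x r x "2 * r" y r]) auto
  also have "(2 * r) powr \<beta> = 2 powr \<beta> * r powr \<beta>" using r by (simp add: powr_mult)
  finally have "\<bar>avg x r - avg y r\<bar> \<le> osc_const * (2 powr \<beta> * r powr \<beta>)" .
  moreover have "\<bar>avg x r - b_rep x\<bar> \<le> concentric_const * r powr \<beta>" "\<bar>avg y r - b_rep y\<bar> \<le> concentric_const * r powr \<beta>"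
    using avg_b_rep_le[OF r] by auto
  moreover have "hoelder_const * r powr \<beta> = 2 * (concentric_const * r powr \<beta>) + osc_const * (2 powr \<beta> * r powr \<beta>)"
    unfolding hoelder_const_def by (simp add: algebra_simps)
  ultimately show ?thesis unfolding r_def[symmetric] by linarith
qed simp

lemma b_rep_measurable [measurable]: "b_rep \<in> borel_measurable lebesgue"
proof -
  have "isCont b_rep x" for x
  proof -
    have "((\<lambda>y. norm (y - x)) \<longlongrightarrow> 0) (at x)" by (rule tendsto_norm_zero[OF LIM_zero[OF tendsto_ident_at]])
    then have "((\<lambda>y. norm (y - x) powr \<beta>) \<longlongrightarrow> 0) (at x)"
      using \<beta> by (intro tendsto_zero_powrI[OF _ tendsto_const]) auto
    then have lim: "((\<lambda>y. hoelder_const * norm (y - x) powr \<beta>) \<longlongrightarrow> 0) (at x)"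
      by (rule tendsto_mult_right_zero)
    have "((\<lambda>y. b_rep y - b_rep x) \<longlongrightarrow> 0) (at x)"
      by (rule Lim_null_comparison[OF _ lim]) (simp add: b_rep_hoelder)
    then show ?thesis unfolding isCont_def by (rule LIM_zero_cancel)
  qed
  then have "b_rep \<in> borel_measurable borel"
    by (intro borel_measurable_continuous_onI) (simp add: continuous_at_imp_continuous_on)
  then show ?thesis by (intro measurable_completion) simp
qed

text \<open>The costs of passing from \<open>b x\<close> to the average over the ball, from there to
  \<open>b_rep\<close> at the centre, and from the centre to \<open>x\<close>.\<close>

definition deviation_const :: real where "deviation_const = K + concentric_const + hoelder_const"

lemma b_rep_deviation_le:
  assumes r: "0 < r"
  shows "(\<integral>\<^sup>+ x\<in>ball z r. ennreal \<bar>b x - b_rep x\<bar> \<partial>lebesgue)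
     \<le> ennreal (deviation_const * r powr \<beta> * measure lebesgue (ball z r))"
proof -
  define V where "V = measure lebesgue (ball z r)"
  have V: "0 < V" unfolding V_def using r by (rule measure_lebesgue_ball_pos)
  have eV: "emeasure lebesgue (ball z r) = ennreal V"
    unfolding V_def using r by (intro emeasure_lebesgue_ball_eq_measure) simp
  let ?J = "\<integral>\<^sup>+ x\<in>ball z r. ennreal \<bar>b x - avg z r\<bar> \<partial>lebesgue"
  have "ennreal V * ?J \<le> ennreal (K * r powr \<beta> * V\<^sup>2)"
    using order_trans[OF scaled_deviation_le[OF _ r] oscillation[OF r]] unfolding V_def by simp
  also have "\<dots> = ennreal V * ennreal (K * r powr \<beta> * V)"
    using V K by (subst ennreal_mult[symmetric]) (auto simp: power2_eq_square mult_ac)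
  finally have J: "?J \<le> ennreal (K * r powr \<beta> * V)"
    using V by (subst (asm) ennreal_mult_le_mult_iff) auto
  have "(\<integral>\<^sup>+ x\<in>ball z r. ennreal \<bar>b x - b_rep x\<bar> \<partial>lebesgue)
     \<le> (\<integral>\<^sup>+ x. ennreal \<bar>b x - avg z r\<bar> * indicator (ball z r) x +
            ennreal ((concentric_const + hoelder_const) * r powr \<beta>) * indicator (ball z r) x \<partial>lebesgue)"
  proof (rule nn_integral_mono)
    fix x
    show "ennreal \<bar>b x - b_rep x\<bar> * indicator (ball z r) x \<le> ennreal \<bar>b x - avg z r\<bar> * indicator (ball z r) x +
            ennreal ((concentric_const + hoelder_const) * r powr \<beta>) * indicator (ball z r) x"
    proof (cases "x \<in> ball z r")
      case True
      have "norm (z - x) powr \<beta> \<le> r powr \<beta>"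
        using True \<beta> by (intro powr_mono2) (auto simp: dist_norm)
      then have "hoelder_const * norm (z - x) powr \<beta> \<le> hoelder_const * r powr \<beta>" using hoelder_const_nonneg by (rule mult_left_mono)
      then have "\<bar>b x - b_rep x\<bar> \<le> \<bar>b x - avg z r\<bar> + (concentric_const + hoelder_const) * r powr \<beta>"
        using avg_b_rep_le[OF r, of z] b_rep_hoelder[of z x] by (simp add: distrib_right)
      then have "ennreal \<bar>b x - b_rep x\<bar> \<le> ennreal (\<bar>b x - avg z r\<bar> + (concentric_const + hoelder_const) * r powr \<beta>)"
        by (rule ennreal_leI)
      then show ?thesis using True concentric_const_bounds hoelder_const_nonneg by (simp add: ennreal_plus)
    qed simp
  qed
  also have "\<dots> = ?J + ennreal ((concentric_const + hoelder_const) * r powr \<beta>) * ennreal V"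
    by (subst nn_integral_add) (measurable, simp add: nn_integral_cmult_indicator eV)
  also have "\<dots> \<le> ennreal (K * r powr \<beta> * V) + ennreal ((concentric_const + hoelder_const) * r powr \<beta>) * ennreal V"
    using J by (rule add_right_mono)
  also have "\<dots> = ennreal (K * r powr \<beta> * V + (concentric_const + hoelder_const) * r powr \<beta> * V)"
    using V K concentric_const_bounds hoelder_const_nonneg by (simp add: ennreal_mult[symmetric] ennreal_plus[symmetric] del: ennreal_plus)
  also have "K * r powr \<beta> * V + (concentric_const + hoelder_const) * r powr \<beta> * V = deviation_const * r powr \<beta> * V"
    unfolding deviation_const_def by (simp add: algebra_simps)
  finally show ?thesis unfolding V_def .
qed

text \<open>
  The measure with density \<open>\<bar>b - b_rep\<bar>\<close> is \<open>O(r\<^sup>n\<^sup>+\<^sup>\<beta>)\<close> on balls of radius \<open>r\<close>, so covering by balls of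
  one small radius shows that it vanishes; this avoids the Lebesgue differentiation theorem.
\<close>

lemma b_rep_deviation_ball_eq_0:
  assumes R: "0 < R"
  shows "(\<integral>\<^sup>+ x\<in>ball 0 R. ennreal \<bar>b x - b_rep x\<bar> \<partial>lebesgue) = 0"
proof -
  let ?X = "\<integral>\<^sup>+ x\<in>ball 0 R. ennreal \<bar>b x - b_rep x\<bar> \<partial>lebesgue"
  have deviation_const: "0 \<le> deviation_const" unfolding deviation_const_def using K concentric_const_bounds hoelder_const_nonneg by simp
  define W where "W = measure lebesgue (ball (0::'a) (R + 1))"
  have eW: "emeasure lebesgue (ball (0::'a) (R + 1)) = ennreal W"
    unfolding W_def using R by (intro emeasure_lebesgue_ball_eq_measure) simp
  have bd: "?X \<le> ennreal (deviation_const * 5 powr \<beta> * 5 ^ DIM('a) * W * r powr \<beta>)" if r: "0 < r" "r \<le> 1" for r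
  proof -
    \<comment> \<open>The deviation bound on a ball of radius \<open>5 * r\<close>, expressed per
      unit volume of the concentric ball of radius \<open>r\<close>.\<close>
    define q where "q = deviation_const * (5 * r) powr \<beta> * 5 ^ DIM('a)"
    have q: "0 \<le> q" unfolding q_def using deviation_const by simp
    have "?X \<le> (\<integral>\<^sup>+ x. ennreal q * indicator (ball (0::'a) (R + 1)) x \<partial>lebesgue)"
    proof (rule nn_integral_le_Vitali[where K = "ball (0::'a) R" and a = "\<lambda>i::'a. i" and r = "\<lambda>_. r" and B = r])
      show "ball 0 R \<subseteq> (\<Union>i\<in>ball (0::'a) R. ball i r)" using r by force
      fix i :: 'a assume i: "i \<in> ball 0 R"
      \<comment> \<open>The bound \<open>r \<le> 1\<close> keeps all covering balls inside one ball
        independent of \<open>r\<close>, so only \<open>r powr \<beta>\<close> varies when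
        \<open>r\<close> tends to 0.\<close>
      have sub: "ball i r \<subseteq> ball 0 (R + 1)"
        using i r by (intro ball_subset_ball_iff[THEN iffD2]) (auto simp: dist_norm)
      have "(\<integral>\<^sup>+ x\<in>ball i (5 * r). ennreal \<bar>b x - b_rep x\<bar> \<partial>lebesgue)
          \<le> ennreal (deviation_const * (5 * r) powr \<beta> * measure lebesgue (ball i (5 * r)))"
        using r by (intro b_rep_deviation_le) simp
      also have "\<dots> = ennreal (q * measure lebesgue (ball i r))"
      proof -
        have "measure lebesgue (ball i (5 * r)) = 5 ^ DIM('a) * measure lebesgue (ball i r)"
          using r by (intro lebesgue_ball_scale) auto
        then show ?thesis unfolding q_def by (simp add: mult_ac)
      qed
      also have "\<dots> = ennreal q * emeasure lebesgue (ball i r)"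
        using r q by (simp add: emeasure_lebesgue_ball_eq_measure ennreal_mult)
      also have "\<dots> = (\<integral>\<^sup>+ x. ennreal q * indicator (ball i r) x \<partial>lebesgue)"
        by (simp add: nn_integral_cmult_indicator)
      also have "\<dots> = (\<integral>\<^sup>+ x\<in>ball i r. ennreal q * indicator (ball (0::'a) (R + 1)) x \<partial>lebesgue)"
        using sub by (intro nn_integral_cong) (auto simp: indicator_def)
      finally show "(\<integral>\<^sup>+ x\<in>ball i (5 * r). ennreal \<bar>b x - b_rep x\<bar> \<partial>lebesgue)
          \<le> (\<integral>\<^sup>+ x\<in>ball i r. ennreal q * indicator (ball (0::'a) (R + 1)) x \<partial>lebesgue)" .
    qed (use r in auto)
    also have "\<dots> = ennreal (q * W)"
      using q by (simp add: nn_integral_cmult_indicator eW ennreal_mult W_def)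
    also have "q * W = deviation_const * 5 powr \<beta> * 5 ^ DIM('a) * W * r powr \<beta>"
      unfolding q_def using r by (simp add: powr_mult)
    finally show ?thesis .
  qed
  have "?X \<le> ennreal 0"
  proof (rule tendsto_lowerbound)
    show "(\<lambda>k. ennreal (deviation_const * 5 powr \<beta> * 5 ^ DIM('a) * W * inverse (real (Suc k)) powr \<beta>)) \<longlonglongrightarrow> ennreal 0"
      by (intro tendsto_ennrealI powr_inverse_Suc_tendsto_0)
    show "eventually (\<lambda>k. ?X \<le> ennreal (deviation_const * 5 powr \<beta> * 5 ^ DIM('a) * W * inverse (real (Suc k)) powr \<beta>)) sequentially"
      by (intro always_eventually allI bd) (auto simp: inverse_le_1_iff)
  qed simp
  then show ?thesis by simp
qed

lemma AE_eq_b_rep: "AE x in lebesgue. b x = b_rep x"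
proof -
  have "AE x in lebesgue. ennreal \<bar>b x - b_rep x\<bar> * indicator (ball 0 (real (Suc k))) x = 0" for k
  proof (rule nn_integral_0_iff_AE[THEN iffD1])
    show "(\<integral>\<^sup>+ x\<in>ball 0 (real (Suc k)). ennreal \<bar>b x - b_rep x\<bar> \<partial>lebesgue) = 0"
      by (rule b_rep_deviation_ball_eq_0) simp
  qed measurable
  then have "AE x in lebesgue. \<forall>k. ennreal \<bar>b x - b_rep x\<bar> * indicator (ball 0 (real (Suc k))) x = 0"
    unfolding AE_all_countable by blast
  then show ?thesis
  proof eventually_elim
    case (elim x)
    obtain k where "norm x < real k" using reals_Archimedean2 by blast
    then have "x \<in> ball 0 (real (Suc k))" by simp
    with elim[rule_format, of k] show ?case by simp
  qed
qed

end

lemma lipschitz_space_necessary: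
  fixes b :: "real^'n \<Rightarrow> real"
  assumes \<beta>: "0 < \<beta>" and b: "locally_integrable b"
    and \<Psi>: "young_function \<Psi>" and Y: "\<Phi> \<in> young_class_Y"
    and C: "0 < C" "\<And>t. 0 < t \<Longrightarrow> young_inverse \<Psi> t \<le> C * young_inverse \<Phi> t * t powr (- ((\<alpha> + \<beta>) / real CARD('n)))"
    and bd: "orlicz_bounded \<Phi> \<Psi> (frac_max_commutator b \<alpha>)"
  shows "b \<in> lipschitz_space \<beta>"
proof -
  have meas: "b \<in> borel_measurable lebesgue" using b by (rule locally_integrable_measurable)
  obtain K where K: "0 \<le> K"
    "\<And>c r. 0 < r \<Longrightarrow> (\<integral>\<^sup>+ x\<in>ball c r. (\<integral>\<^sup>+ y\<in>ball c r. ennreal \<bar>b x - b y\<bar> \<partial>lebesgue) \<partial>lebesgue)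
        \<le> ennreal (K * r powr \<beta> * (measure lebesgue (ball c r))\<^sup>2)"
    by (rule oscillation_bound_necessary[OF \<Psi> Y meas C bd]) (assumption, rule that)
  have "set_integrable lebesgue (ball c r) b" for c r
  proof (rule set_integrable_subset)
    show "set_integrable lebesgue (cball c r) b"
      using b compact_cball unfolding locally_integrable_def by blast
  qed (simp_all add: ball_subset_cball)
  then interpret campanato b \<beta> K
    using \<beta> K meas by unfold_locales auto
  show ?thesis
    unfolding lipschitz_space_def using AE_eq_b_rep b_rep_hoelder
    by (intro CollectI exI[of _ b_rep] conjI exI[of _ hoelder_const] allI)
qed

theorem theorem4p5:
  fixes \<alpha> \<beta> :: real
    and b :: "real^'n \<Rightarrow> real"
    and \<Phi> \<Psi> :: "real \<Rightarrow> ennreal"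
  assumes "0 < \<beta>" and "\<beta> < 1"
    and "0 \<le> \<alpha>" and "\<alpha> < real CARD('n)"
    and "0 < \<alpha> + \<beta>" and "\<alpha> + \<beta> < real CARD('n)"
    and "locally_integrable b"
    and "young_function \<Phi>" and "young_function \<Psi>"
    and "\<Phi> \<in> young_class_Y"
  shows
    "(nabla2 \<Phi> \<and>
        (\<exists>C>0. \<forall>t>0. t powr (- ((\<alpha> + \<beta>) / real CARD('n))) * young_inverse \<Phi> t
                        \<le> C * young_inverse \<Psi> t)
      \<longrightarrow> (b \<in> lipschitz_space \<beta> \<longrightarrow> orlicz_bounded \<Phi> \<Psi> (frac_max_commutator b \<alpha>))) \<and>
     ((\<exists>C>0. \<forall>t>0. young_inverse \<Psi> t
                        \<le> C * young_inverse \<Phi> t * t powr (- ((\<alpha> + \<beta>) / real CARD('n))))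
      \<longrightarrow> (orlicz_bounded \<Phi> \<Psi> (frac_max_commutator b \<alpha>) \<longrightarrow> b \<in> lipschitz_space \<beta>)) \<and>
     (nabla2 \<Phi> \<and>
        (\<exists>C\<^sub>1>0. \<exists>C\<^sub>2>0. \<forall>t>0.
            C\<^sub>1 * young_inverse \<Phi> t * t powr (- ((\<alpha> + \<beta>) / real CARD('n))) \<le> young_inverse \<Psi> t \<and>
            young_inverse \<Psi> t \<le> C\<^sub>2 * young_inverse \<Phi> t * t powr (- ((\<alpha> + \<beta>) / real CARD('n))))
      \<longrightarrow> (b \<in> lipschitz_space \<beta> \<longleftrightarrow> orlicz_bounded \<Phi> \<Psi> (frac_max_commutator b \<alpha>)))"
proof -
  let ?e = "(\<alpha> + \<beta>) / real CARD('n)"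
  have suff: "orlicz_bounded \<Phi> \<Psi> (frac_max_commutator b \<alpha>)"
    if "nabla2 \<Phi>" "0 < C" "\<And>t. 0 < t \<Longrightarrow> t powr (- ?e) * young_inverse \<Phi> t \<le> C * young_inverse \<Psi> t"
      "b \<in> lipschitz_space \<beta>" for C
    by (rule orlicz_bounded_sufficient[OF assms(1,3,8,9,10) that])
  have nec: "b \<in> lipschitz_space \<beta>"
    if "0 < C" "\<And>t. 0 < t \<Longrightarrow> young_inverse \<Psi> t \<le> C * young_inverse \<Phi> t * t powr (- ?e)"
      "orlicz_bounded \<Phi> \<Psi> (frac_max_commutator b \<alpha>)" for C
    by (rule lipschitz_space_necessary[OF assms(1,7,9,10) that])
  \<comment> \<open>The lower estimate of the two-sided condition is the hypothesis of
    \<open>suff\<close> with the reciprocal constant.\<close>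
  have suff': "orlicz_bounded \<Phi> \<Psi> (frac_max_commutator b \<alpha>)"
    if "nabla2 \<Phi>" "0 < C" "\<And>t. 0 < t \<Longrightarrow> C * young_inverse \<Phi> t * t powr (- ?e) \<le> young_inverse \<Psi> t"
      "b \<in> lipschitz_space \<beta>" for C
  proof (rule suff[OF that(1) _ _ that(4)])
    show "0 < 1 / C" using that(2) by simp
    show "t powr (- ?e) * young_inverse \<Phi> t \<le> 1 / C * young_inverse \<Psi> t" if "0 < t" for t
    proof -
      have "C * (t powr (- ?e) * young_inverse \<Phi> t) \<le> young_inverse \<Psi> t"
        using \<open>\<And>t. 0 < t \<Longrightarrow> C * young_inverse \<Phi> t * t powr (- ?e) \<le> young_inverse \<Psi> t\<close>[OF that]
        by (simp only: mult_ac)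
      then show ?thesis using \<open>0 < C\<close> by (simp add: pos_le_divide_eq mult.commute)
    qed
  qed
  show ?thesis
  proof (intro conjI impI)
    assume "nabla2 \<Phi> \<and> (\<exists>C>0. \<forall>t>0. t powr (- ?e) * young_inverse \<Phi> t \<le> C * young_inverse \<Psi> t)"
      and "b \<in> lipschitz_space \<beta>"
    then show "orlicz_bounded \<Phi> \<Psi> (frac_max_commutator b \<alpha>)" using suff by blast
  next
    assume "\<exists>C>0. \<forall>t>0. young_inverse \<Psi> t \<le> C * young_inverse \<Phi> t * t powr (- ?e)"
      and "orlicz_bounded \<Phi> \<Psi> (frac_max_commutator b \<alpha>)"
    then show "b \<in> lipschitz_space \<beta>" using nec by blast
  next
    assume "nabla2 \<Phi> \<and> (\<exists>C\<^sub>1>0. \<exists>C\<^sub>2>0. \<forall>t>0.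
        C\<^sub>1 * young_inverse \<Phi> t * t powr (- ?e) \<le> young_inverse \<Psi> t \<and>
        young_inverse \<Psi> t \<le> C\<^sub>2 * young_inverse \<Phi> t * t powr (- ?e))"
    then show "b \<in> lipschitz_space \<beta> \<longleftrightarrow> orlicz_bounded \<Phi> \<Psi> (frac_max_commutator b \<alpha>)"
      using suff' nec by blast
  qed
qed

end
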